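(* For each $c>\frac32$ the systole of $(\Sigma_R^c,\lambda_{can})$ is $$l_1(\Sigma_R^c,\lambda_{can})=2\pi L_R(c),$$ where $L_R(c)$ is the positive zero of the equation $c=\frac{1}{2x^2}-x$.
   Context: The systole $l_1(\Sigma,\lambda)$ of a contact manifold $(\Sigma,\lambda)$ is the smallest period of its periodic Reeb orbits. Rotating Kepler problem: $H_R(q,p)=\frac12|p|^2-\frac1{|q|}+p_1q_2-p_2q_1$ on $T^*(\mathbb{R}^2\setminus\{0\})$ with symplectic form $dp\wedge dq$; its unique critical value is $-\frac32$. Let $\Psi(q,p)=(p,-q)$ and let $\Phi:T^*\mathbb{R}^2\to T^*(S^2\setminus\{\text{north pole}\})$ be the cotangent lift of inverse stereographic projection $\phi(x)=\frac{1}{|x|^2+1}(2x_1,2x_2,|x|^2-1)$. For $c>\frac32$, $\Sigma_R^c$ is the bounded component of the closure in $T^*S^2$ of $\Phi\circ\Psi(H_R^{-1}(-c))$; it is known to be a fiberwise convex hypersurface, so the canonical 1-form $\lambda_{can}$ of $T^*S^2$ restricts to a contact form on it. *)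

theory Defs
  imports "HOL-Analysis.Analysis"
begin

section \<open>Reeb orbits and the systole\<close>

text \<open>
  Hypersurfaces are subsets \<open>M\<close> of a Euclidean space \<open>'a\<close>, and a 1-form on \<open>M\<close> is the restriction
  of a 1-form \<open>\<alpha>\<close> on \<open>'a\<close>; \<open>\<alpha> z v\<close> is the value of \<open>\<alpha>\<close> at the point \<open>z\<close> on the vector \<open>v\<close>.
\<close>

definition tangent_space :: "'a::euclidean_space set \<Rightarrow> 'a \<Rightarrow> 'a set" where
  "tangent_space M z = {v. \<exists>\<gamma> e. e > 0 \<and> (\<forall>t\<in>{-e<..<e}. \<gamma> t \<in> M) \<and> \<gamma> 0 = z \<and>
     (\<gamma> has_vector_derivative v) (at (0::real))}"

text \<open>
  The exterior derivative \<open>d\<alpha>(v, w) = v(\<alpha>(w)) - w(\<alpha>(v))\<close>, with \<open>v\<close> and \<open>w\<close> extended to constant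
  vector fields on the ambient space.  Its restriction to tangent vectors of \<open>M\<close> is the exterior
  derivative of the restriction of \<open>\<alpha>\<close> to \<open>M\<close>.
\<close>

definition ext_deriv ::
    "('a::euclidean_space \<Rightarrow> 'a \<Rightarrow> real) \<Rightarrow> 'a \<Rightarrow> 'a \<Rightarrow> 'a \<Rightarrow> real" where
  "ext_deriv \<alpha> z v w =
     frechet_derivative (\<lambda>u. \<alpha> u w) (at z) v - frechet_derivative (\<lambda>u. \<alpha> u v) (at z) w"

definition is_reeb_vector ::
    "'a::euclidean_space set \<Rightarrow> ('a \<Rightarrow> 'a \<Rightarrow> real) \<Rightarrow> 'a \<Rightarrow> 'a \<Rightarrow> bool" where
  "is_reeb_vector M \<alpha> z R \<longleftrightarrow>
     R \<in> tangent_space M z \<and> \<alpha> z R = 1 \<and> (\<forall>w\<in>tangent_space M z. ext_deriv \<alpha> z R w = 0)"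

definition reeb_orbit ::
    "'a::euclidean_space set \<Rightarrow> ('a \<Rightarrow> 'a \<Rightarrow> real) \<Rightarrow> (real \<Rightarrow> 'a) \<Rightarrow> bool" where
  "reeb_orbit M \<alpha> \<gamma> \<longleftrightarrow>
     (\<forall>t. \<gamma> t \<in> M \<and> (\<exists>R. is_reeb_vector M \<alpha> (\<gamma> t) R \<and> (\<gamma> has_vector_derivative R) (at t)))"

definition reeb_periods :: "'a::euclidean_space set \<Rightarrow> ('a \<Rightarrow> 'a \<Rightarrow> real) \<Rightarrow> real set" where
  "reeb_periods M \<alpha> = {T. T > 0 \<and> (\<exists>\<gamma>. reeb_orbit M \<alpha> \<gamma> \<and> (\<forall>t. \<gamma> (t + T) = \<gamma> t))}"

definition has_systole :: "'a::euclidean_space set \<Rightarrow> ('a \<Rightarrow> 'a \<Rightarrow> real) \<Rightarrow> real \<Rightarrow> bool" where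
  "has_systole M \<alpha> l \<longleftrightarrow> l \<in> reeb_periods M \<alpha> \<and> (\<forall>T\<in>reeb_periods M \<alpha>. l \<le> T)"

text \<open>Meaningful only if a smallest period exists, that is, if \<open>has_systole M \<alpha> l\<close> for some \<open>l\<close>.\<close>

definition systole :: "'a::euclidean_space set \<Rightarrow> ('a \<Rightarrow> 'a \<Rightarrow> real) \<Rightarrow> real" where
  "systole M \<alpha> = (THE l. has_systole M \<alpha> l)"

section \<open>The cotangent bundle of the 2-sphere\<close>

text \<open>
  A covector of the unit sphere at \<open>x\<close> is identified, by the Euclidean inner product, with a vector
  \<open>y\<close> orthogonal to \<open>x\<close>.  With \<open>\<pi> (x, y) = x\<close>, the canonical 1-form \<open>y \<circ> d\<pi>\<close> is then the
  restriction of \<open>y dx\<close> on \<open>\<real>\<^sup>3 \<times> \<real>\<^sup>3\<close>.  Covectors of the plane are likewise vectors of the plane.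
\<close>

definition cotangent_S2 :: "((real^3) \<times> (real^3)) set" where
  "cotangent_S2 = {(x, y). norm x = 1 \<and> x \<bullet> y = 0}"

definition lambda_can :: "(real^3) \<times> (real^3) \<Rightarrow> (real^3) \<times> (real^3) \<Rightarrow> real" where
  "lambda_can z w = snd z \<bullet> fst w"

definition inv_stereo :: "real^2 \<Rightarrow> real^3" where
  "inv_stereo x = (1 / ((norm x)\<^sup>2 + 1)) *\<^sub>R vector [2 * x$1, 2 * x$2, (norm x)\<^sup>2 - 1]"

text \<open>
  The covector \<open>y\<close> at \<open>x\<close> is sent to \<open>y \<circ> (d\<phi>\<^sub>x)\<^sup>-\<^sup>1\<close> at \<open>\<phi> x\<close>, where \<open>\<phi>\<close> is \<open>inv_stereo\<close>: the tangent
  vector \<open>\<eta>\<close> of the sphere at \<open>\<phi> x\<close> that satisfies \<open>\<eta> \<bullet> d\<phi>\<^sub>x v = y \<bullet> v\<close> for all \<open>v\<close>.  It exists and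
  is unique because \<open>d\<phi>\<^sub>x\<close> is an isomorphism onto the tangent plane.
\<close>

definition Phi :: "(real^2) \<times> (real^2) \<Rightarrow> (real^3) \<times> (real^3)" where
  "Phi = (\<lambda>(x, y). (inv_stereo x,
     THE \<eta>. inv_stereo x \<bullet> \<eta> = 0 \<and>
       (\<forall>v. \<eta> \<bullet> frechet_derivative inv_stereo (at x) v = y \<bullet> v)))"

section \<open>The rotating Kepler problem\<close>

definition H_R :: "(real^2) \<times> (real^2) \<Rightarrow> real" where
  "H_R = (\<lambda>(q, p). (norm p)\<^sup>2 / 2 - 1 / norm q + p$1 * q$2 - p$2 * q$1)"

definition level_R :: "real \<Rightarrow> ((real^2) \<times> (real^2)) set" where
  "level_R c = {(q, p). q \<noteq> 0 \<and> H_R (q, p) = - c}"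

definition Psi :: "(real^2) \<times> (real^2) \<Rightarrow> (real^2) \<times> (real^2)" where
  "Psi = (\<lambda>(q, p). (p, - q))"

text \<open>For \<open>c > 3/2\<close> the closure has two components, exactly one of which is bounded.\<close>

definition Sigma_R :: "real \<Rightarrow> ((real^3) \<times> (real^3)) set" where
  "Sigma_R c =
     (THE C. C \<in> components (cotangent_S2 \<inter> closure ((Phi \<circ> Psi) ` level_R c)) \<and> bounded C)"

definition L_R :: "real \<Rightarrow> real" where
  "L_R c = (THE x. x > 0 \<and> c = 1 / (2 * x\<^sup>2) - x)"

end

theory Submission
  imports Defs
begin

text \<open>
  Write \<open>x = p\<close>, \<open>y = - q\<close> and \<open>z = (\<xi>, \<eta>) = \<Phi> (x, y)\<close>.  Then \<open>|q| = |\<eta>| (1 - \<xi>\<^sub>3)\<close>, the angular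
  momentum is \<open>J = \<xi>\<^sub>1 \<eta>\<^sub>2 - \<xi>\<^sub>2 \<eta>\<^sub>1\<close>, and \<open>H_R = - c\<close> becomes the equation \<open>moser_ham c z = 1\<close>, which makes
  sense over the north pole, where the collisions lie.  On a ray of covectors it is a quadratic
  equation for the length, and for \<open>c > 3/2\<close> its discriminant is positive.  The smallest
  positive root is bounded and depends continuously on the direction, so it sweeps out a copy of
  the unit bundle of the sphere; on the larger root one can push the covector to infinity.
  Hence \<open>Sigma_R c\<close> is the part of the level given by the smallest positive root (\<open>Sigma_R_eq\<close>).

  Along a Reeb orbit \<open>J\<close> is constant, hence so is the Kepler energy \<open>- r\<^sup>2 / 2 = J - c\<close>.  Rescaling the
  momenta by \<open>1 / r\<close> turns the Kepler motion of this energy into a geodesic motion on the sphere.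
  The frame formed by the rescaled point, its unit velocity and their cross product \<open>n\<close> is therefore
  turned about \<open>n\<close> by the Kepler motion and about the vertical axis by the rotation of the
  coordinates, while \<open>n\<^sub>3 = r J\<close> stays constant.  By Kepler's equation the two angles advance at the
  constant rates \<open>r\<^sup>3 / (r\<^sup>2 - J)\<close> and \<open>- 1 / (r\<^sup>2 - J)\<close> in the time \<open>t + \<eta>\<^sub>3\<close>, if \<open>\<nu>\<^sub>3 = r \<eta>\<^sub>3\<close> is added
  to the first angle; here \<open>\<nu>\<close> is the unit velocity, and \<open>t\<close> is the Reeb time.  As \<open>\<eta>\<^sub>3\<close> returns
  after a period, this change of time does not change periods.

  The sum of the two angles, before the correction by \<open>\<nu>\<^sub>3\<close>, is the argument of an explicit function
  on the level whose modulus is \<open>1 + r J\<close> (\<open>phase_norm\<close>).  Where this is nonzero, a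
  period \<open>T\<close> satisfies \<open>\<omega> T \<in> 2 \<pi> \<int>\<close> with \<open>\<omega> = (r\<^sup>3 - 1) / (r\<^sup>2 - J)\<close>, and \<open>0 < \<omega> \<le> r\<close> because
  \<open>r > 1\<close> and \<open>r J \<le> 1\<close>.  If \<open>r J = - 1\<close>, the difference of the angles takes over; it is
  obtained by replacing \<open>r\<close> by \<open>- r\<close>, and it moves at the rate \<open>- r\<close>.
  In both cases \<open>T \<ge> 2 \<pi> / r\<close>.  Finally \<open>c = r\<^sup>2 / 2 + J \<ge> r\<^sup>2 / 2 - 1 / r\<close>, which is \<open>1 / r \<ge> L_R c\<close>.
  Equality holds throughout on the circular orbit with \<open>r J = - 1\<close>, so it realizes the systole.
\<close>

section \<open>The regularized energy level on the cotangent bundle of the sphere\<close>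

text \<open>
  With \<open>x = p\<close> and \<open>y = - q\<close> this is the angular momentum \<open>q\<^sub>1 p\<^sub>2 - q\<^sub>2 p\<^sub>1\<close> of the Kepler problem.
\<close>

definition ang_mom :: "(real^3) \<times> (real^3) \<Rightarrow> real" where
  "ang_mom z = fst z $ 1 * snd z $ 2 - fst z $ 2 * snd z $ 1"

text \<open>
  This is \<open>|q| (H_R + c) + 1\<close>.  The factor \<open>|q|\<close> removes the pole of \<open>H_R\<close> at \<open>q = 0\<close> and does not
  change the level set \<open>H_R = - c\<close>.
\<close>

definition moser_ham :: "real \<Rightarrow> (real^3) \<times> (real^3) \<Rightarrow> real" where
  "moser_ham c z = norm (snd z) * ((1 + fst z $ 3) / 2 + (1 - fst z $ 3) * (c - ang_mom z))"

text \<open>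
  The distance \<open>|q|\<close> to the origin: inverse stereographic projection has conformal factor
  \<open>1 - \<xi>\<^sub>3\<close>, and covectors scale by its inverse.
\<close>

definition orbit_radius :: "(real^3) \<times> (real^3) \<Rightarrow> real" where
  "orbit_radius z = norm (snd z) * (1 - fst z $ 3)"

definition energy_level :: "real \<Rightarrow> ((real^3) \<times> (real^3)) set" where
  "energy_level c = {z \<in> cotangent_S2. moser_ham c z = 1}"

text \<open>
  If \<open>\<rho>\<close> is the length of the covector, the energy equation on a ray reads \<open>a \<rho>\<^sup>2 - b \<rho> + 1 = 0\<close> and the
  left-hand side of the inequality is \<open>a \<rho>\<^sup>2\<close>.  If \<open>a > 0\<close>, the roots have product \<open>1 / a\<close> and the
  inequality selects the smaller one; if \<open>a \<le> 0\<close>, there is only one positive root.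
\<close>

definition bounded_level :: "real \<Rightarrow> ((real^3) \<times> (real^3)) set" where
  "bounded_level c = {z \<in> energy_level c. orbit_radius z * ang_mom z < 1}"

lemma inner3: "x \<bullet> y = x$1 * y$1 + x$2 * y$2 + x$3 * y$3" for x y :: "real^3"
  by (simp add: inner_vec_def sum_3)

lemma inner2: "x \<bullet> y = x$1 * y$1 + x$2 * y$2" for x y :: "real^2"
  by (simp add: inner_vec_def sum_2)

lemma norm3_sq: "(norm x)\<^sup>2 = (x$1)\<^sup>2 + (x$2)\<^sup>2 + (x$3)\<^sup>2" for x :: "real^3"
  unfolding power2_norm_eq_inner by (simp add: inner3 power2_eq_square)

lemma norm2_sq: "(norm x)\<^sup>2 = (x$1)\<^sup>2 + (x$2)\<^sup>2" for x :: "real^2"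
  unfolding power2_norm_eq_inner by (simp add: inner2 power2_eq_square)

lemma vec3_eq: "x = y \<longleftrightarrow> x$1 = y$1 \<and> x$2 = y$2 \<and> x$3 = y$3" for x y :: "real^3"
  by (simp add: vec_eq_iff forall_3)

lemma cotangent_S2D:
  assumes "z \<in> cotangent_S2"
  shows "(fst z$1)\<^sup>2 + (fst z$2)\<^sup>2 + (fst z$3)\<^sup>2 = 1"
    and "fst z$1 * snd z$1 + fst z$2 * snd z$2 + fst z$3 * snd z$3 = 0"
    and "fst z \<bullet> fst z = 1" and "fst z \<bullet> snd z = 0"
  using assms norm3_sq[of "fst z"] by (auto simp: cotangent_S2_def inner3 case_prod_beta power2_eq_square)

lemma inv_stereo_nth:
  "inv_stereo x $ 1 = 2 * x$1 / ((norm x)\<^sup>2 + 1)"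
  "inv_stereo x $ 2 = 2 * x$2 / ((norm x)\<^sup>2 + 1)"
  "inv_stereo x $ 3 = ((norm x)\<^sup>2 - 1) / ((norm x)\<^sup>2 + 1)"
  by (simp_all add: inv_stereo_def)

lemma has_derivative_inv_stereo:
  "(inv_stereo has_derivative (\<lambda>v. (2 / ((norm x)\<^sup>2 + 1)) *\<^sub>R vector [v$1, v$2, x \<bullet> v]
      - (2 * (x \<bullet> v) / ((norm x)\<^sup>2 + 1)) *\<^sub>R inv_stereo x)) (at x)"
proof -
  have N: "x \<bullet> x + 1 \<noteq> 0"
    by (metis inner_ge_zero add_nonneg_pos less_numeral_extra(1) less_irrefl)
  have eq: "inv_stereo = (\<lambda>x. (1 / (x \<bullet> x + 1)) *\<^sub>R
      ((2 * x$1) *\<^sub>R axis 1 1 + (2 * x$2) *\<^sub>R axis 2 1 + (x \<bullet> x - 1) *\<^sub>R axis 3 1))"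
    by (simp add: fun_eq_iff vec3_eq inv_stereo_nth power2_norm_eq_inner axis_def)
  note nth = bounded_linear.has_derivative[OF bounded_linear_vec_nth]
  show ?thesis
    apply (subst eq)
    apply (rule has_derivative_eq_rhs)
     apply (rule derivative_eq_intros nth refl N)+
    using N apply (simp add: fun_eq_iff vec3_eq inv_stereo_nth power2_norm_eq_inner axis_def)
    apply (simp add: field_simps inner_commute)
    done
qed

text \<open>
  The cotangent lift of inverse stereographic projection.  The third component is \<open>x \<bullet> y\<close> because
  the radial vector field of the plane is carried to the gradient of the height on the sphere.
\<close>

definition covector_lift :: "real^2 \<Rightarrow> real^2 \<Rightarrow> real^3" where
  "covector_lift x y = vector
     [((norm x)\<^sup>2 + 1) / 2 * y$1 - (x \<bullet> y) * x$1, ((norm x)\<^sup>2 + 1) / 2 * y$2 - (x \<bullet> y) * x$2, x \<bullet> y]"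

lemma norm_sq_plus_1_pos: "(norm x)\<^sup>2 + 1 > (0::real)"
  by (simp add: add_nonneg_pos)

lemma Phi_eq: "Phi (x, y) = (inv_stereo x, covector_lift x y)"
proof -
  let ?N = "(norm x)\<^sup>2 + 1"
  let ?D = "\<lambda>v. (2 / ?N) *\<^sub>R vector [v$1, v$2, x \<bullet> v] - (2 * (x \<bullet> v) / ?N) *\<^sub>R inv_stereo x :: real^3"
  have N: "?N > 0" by (rule norm_sq_plus_1_pos)
  have D: "frechet_derivative inv_stereo (at x) = ?D"
    using frechet_derivative_at[OF has_derivative_inv_stereo] by metis
  have inn: "\<eta> \<bullet> ?D v = (2 / ?N) * (\<eta>$1 * v$1 + \<eta>$2 * v$2 + \<eta>$3 * (x \<bullet> v)) - (2 * (x \<bullet> v) / ?N) * (inv_stereo x \<bullet> \<eta>)"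
    for \<eta> v
    by (simp only: inner_diff_right inner_scaleR_right) (simp add: inner3 algebra_simps)
  have ortho: "inv_stereo x \<bullet> \<eta> = (2 * x$1 * \<eta>$1 + 2 * x$2 * \<eta>$2 + ((norm x)\<^sup>2 - 1) * \<eta>$3) / ?N" for \<eta>
    by (simp add: inner3 inv_stereo_nth add_divide_distrib)
  have "(THE \<eta>. inv_stereo x \<bullet> \<eta> = 0 \<and> (\<forall>v. \<eta> \<bullet> ?D v = y \<bullet> v)) = covector_lift x y"
  proof (rule the_equality)
    have o: "inv_stereo x \<bullet> covector_lift x y = 0"
      unfolding ortho by (simp add: covector_lift_def inner2 norm2_sq)
        (simp add: field_simps power2_eq_square)
    have "covector_lift x y \<bullet> ?D v = y \<bullet> v" for v
      using N unfolding inn o by (simp add: covector_lift_def inner2 field_simps)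
    with o show "inv_stereo x \<bullet> covector_lift x y = 0 \<and> (\<forall>v. covector_lift x y \<bullet> ?D v = y \<bullet> v)" by blast
  next
    fix \<eta> assume A: "inv_stereo x \<bullet> \<eta> = 0 \<and> (\<forall>v. \<eta> \<bullet> ?D v = y \<bullet> v)"
    have *: "2 * (\<eta>$1 * v$1 + \<eta>$2 * v$2 + \<eta>$3 * (x \<bullet> v)) = ?N * (y \<bullet> v)" for v
      using A N inn[of \<eta> v] by (simp add: field_simps)
    have 1: "2 * (\<eta>$1 + \<eta>$3 * x$1) = ?N * y$1" using *[of "axis 1 1"] by (simp add: inner2 axis_def)
    have 2: "2 * (\<eta>$2 + \<eta>$3 * x$2) = ?N * y$2" using *[of "axis 2 1"] by (simp add: inner2 axis_def)
    have 3: "2 * x$1 * \<eta>$1 + 2 * x$2 * \<eta>$2 + ((norm x)\<^sup>2 - 1) * \<eta>$3 = 0"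
      using A N ortho[of \<eta>] by simp
    have "?N * \<eta>$3 = ?N * (x \<bullet> y)"
      using 1 2 3 by (simp add: inner2 norm2_sq) algebra
    then have 4: "\<eta>$3 = x \<bullet> y" using N by simp
    show "\<eta> = covector_lift x y"
      using 1 2 4 by (auto simp: vec3_eq covector_lift_def field_simps)
  qed
  then show ?thesis by (simp add: Phi_def D)
qed


lemma inv_stereo_1_minus: "1 - inv_stereo x $ 3 = 2 / ((norm x)\<^sup>2 + 1)"
  and inv_stereo_1_plus: "1 + inv_stereo x $ 3 = 2 * (norm x)\<^sup>2 / ((norm x)\<^sup>2 + 1)"
  using norm_sq_plus_1_pos[of x] by (simp_all add: inv_stereo_nth field_simps)

lemma norm_covector_lift: "norm (covector_lift x y) = ((norm x)\<^sup>2 + 1) / 2 * norm y"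
proof -
  have "(norm (covector_lift x y))\<^sup>2 = (((norm x)\<^sup>2 + 1) / 2 * norm y)\<^sup>2"
    unfolding norm3_sq power_mult_distrib norm2_sq[of y]
    by (simp add: covector_lift_def inner2 norm2_sq) (simp add: field_simps power2_eq_square)
  then show ?thesis by (simp add: power2_eq_iff_nonneg)
qed

lemma Phi_in_cotangent_S2: "Phi (x, y) \<in> cotangent_S2"
proof -
  have N: "(norm x)\<^sup>2 + 1 > 0" by (rule norm_sq_plus_1_pos)
  have "(norm (inv_stereo x))\<^sup>2 = (4 * (norm x)\<^sup>2 + ((norm x)\<^sup>2 - 1)\<^sup>2) / ((norm x)\<^sup>2 + 1)\<^sup>2"
    unfolding norm3_sq inv_stereo_nth power_divide norm2_sq[of x] by (simp add: power_mult_distrib add_divide_distrib)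
  also have "4 * (norm x)\<^sup>2 + ((norm x)\<^sup>2 - 1)\<^sup>2 = ((norm x)\<^sup>2 + 1)\<^sup>2"
    by (simp add: algebra_simps power2_eq_square)
  also have "\<dots> / ((norm x)\<^sup>2 + 1)\<^sup>2 = 1" using N by simp
  finally have "norm (inv_stereo x) = 1" by (metis norm_ge_zero power2_eq_iff_nonneg one_power2 zero_le_one)
  moreover have "inv_stereo x \<bullet> covector_lift x y =
      (2 * x$1 * covector_lift x y$1 + 2 * x$2 * covector_lift x y$2 + ((norm x)\<^sup>2 - 1) * covector_lift x y$3) / ((norm x)\<^sup>2 + 1)"
    by (simp add: inner3 inv_stereo_nth add_divide_distrib)
  then have "inv_stereo x \<bullet> covector_lift x y = 0"
    by (simp add: covector_lift_def inner2 norm2_sq) (simp add: field_simps power2_eq_square)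
  ultimately show ?thesis by (simp add: cotangent_S2_def Phi_eq)
qed

lemma ang_mom_Phi: "ang_mom (Phi (x, y)) = x$1 * y$2 - x$2 * y$1"
proof -
  define N where "N = (norm x)\<^sup>2 + 1"
  have N: "N > 0" unfolding N_def by (rule norm_sq_plus_1_pos)
  have "ang_mom (Phi (x, y)) = (2 * x$1 * covector_lift x y$2 - 2 * x$2 * covector_lift x y$1) / N"
    by (simp add: ang_mom_def Phi_eq inv_stereo_nth diff_divide_distrib flip: N_def)
  also have "\<dots> = x$1 * y$2 - x$2 * y$1"
    using N by (simp add: covector_lift_def inner2 flip: N_def) (simp add: field_simps)
  finally show ?thesis .
qed

lemma moser_ham_Phi:
  "moser_ham c (Phi (x, y)) = norm y * ((norm x)\<^sup>2 / 2 + c - (x$1 * y$2 - x$2 * y$1))"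
proof -
  define N where "N = (norm x)\<^sup>2 + 1"
  have N: "N > 0" unfolding N_def by (rule norm_sq_plus_1_pos)
  show ?thesis
    unfolding moser_ham_def ang_mom_Phi
    using N by (simp add: Phi_eq inv_stereo_1_minus inv_stereo_1_plus norm_covector_lift flip: N_def)
      (simp add: field_simps)
qed

text \<open>
  Stereographic projection from the north pole inverts \<open>\<Phi>\<close> off that pole.
\<close>

lemma Phi_surj:
  assumes z: "z \<in> cotangent_S2" and z3: "fst z $ 3 < 1"
  shows "\<exists>x y. z = Phi (x, y)"
proof -
  obtain \<xi> \<eta> where ze: "z = (\<xi>, \<eta>)" by force
  define s where "s = 1 - \<xi>$3"
  have s: "s > 0" using z3 by (simp add: s_def ze)
  have s3: "\<xi>$3 = 1 - s" by (simp add: s_def)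
  have n: "(\<xi>$1)\<^sup>2 + (\<xi>$2)\<^sup>2 + (\<xi>$3)\<^sup>2 = 1" and o: "\<xi>$1 * \<eta>$1 + \<xi>$2 * \<eta>$2 + \<xi>$3 * \<eta>$3 = 0"
    using cotangent_S2D[OF z] by (simp_all add: ze)
  define x :: "real^2" where "x = vector [\<xi>$1 / s, \<xi>$2 / s]"
  define y :: "real^2" where "y = vector [s * \<eta>$1 + \<xi>$1 * \<eta>$3, s * \<eta>$2 + \<xi>$2 * \<eta>$3]"
  have n': "(\<xi>$1)\<^sup>2 + (\<xi>$2)\<^sup>2 = s * (2 - s)"
    using n unfolding s3 by (simp add: field_simps power2_eq_square)
  have nx: "(norm x)\<^sup>2 = (2 - s) / s"
  proof -
    have "(norm x)\<^sup>2 = ((\<xi>$1)\<^sup>2 + (\<xi>$2)\<^sup>2) / s\<^sup>2"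
      by (simp add: norm2_sq x_def power_divide add_divide_distrib)
    then show ?thesis using s unfolding n' by (simp add: power2_eq_square)
  qed
  have nx1: "(norm x)\<^sup>2 + 1 = 2 / s" unfolding nx using s by (simp add: field_simps)
  have ix: "inv_stereo x = \<xi>"
    unfolding vec3_eq inv_stereo_nth nx1 using s unfolding nx by (simp add: x_def s3 field_simps)
  have xy: "x \<bullet> y = \<eta>$3"
  proof -
    have "s * (x \<bullet> y) = s * (\<xi>$1 * \<eta>$1 + \<xi>$2 * \<eta>$2) + ((\<xi>$1)\<^sup>2 + (\<xi>$2)\<^sup>2) * \<eta>$3"
      using s by (simp add: inner2 x_def y_def field_simps power2_eq_square)
    also have "\<dots> = s * (- ((1 - s) * \<eta>$3)) + s * (2 - s) * \<eta>$3"
      using o unfolding n' s3 by (metis eq_neg_iff_add_eq_0)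
    also have "\<dots> = s * \<eta>$3" by (simp add: algebra_simps)
    finally show ?thesis using s by simp
  qed
  have "covector_lift x y = \<eta>"
    unfolding covector_lift_def xy nx1 vec3_eq using s by (simp add: x_def y_def field_simps)
  then have "z = Phi (x, y)" by (simp add: Phi_eq ix ze)
  then show ?thesis by blast
qed

lemma image_level:
  "(Phi \<circ> Psi) ` level_R c = {z \<in> energy_level c. fst z $ 3 < 1}"
proof (intro equalityI subsetI)
  fix z assume "z \<in> (Phi \<circ> Psi) ` level_R c"
  then obtain q p where q: "q \<noteq> 0" and H: "H_R (q, p) = - c" and z: "z = Phi (p, - q)"
    by (auto simp: level_R_def Psi_def)
  have "moser_ham c z = 1"
    using H q unfolding z moser_ham_Phi by (simp add: H_R_def field_simps)
  moreover have "0 < 1 - inv_stereo p $ 3"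
    unfolding inv_stereo_1_minus using norm_sq_plus_1_pos[of p] by simp
  then have "fst z $ 3 < 1" by (simp add: z Phi_eq)
  ultimately show "z \<in> {z \<in> energy_level c. fst z $ 3 < 1}"
    using Phi_in_cotangent_S2 by (simp add: energy_level_def z)
next
  fix z assume z: "z \<in> {z \<in> energy_level c. fst z $ 3 < 1}"
  then obtain x y where xy: "z = Phi (x, y)" using Phi_surj[of z] unfolding energy_level_def by blast
  have m: "norm y * ((norm x)\<^sup>2 / 2 + c - (x$1 * y$2 - x$2 * y$1)) = 1"
    using z moser_ham_Phi[of c x y] by (simp add: energy_level_def xy)
  then have y: "y \<noteq> 0" by auto
  have "H_R (- y, x) = - c" using m y by (simp add: H_R_def field_simps)
  then have "(- y, x) \<in> level_R c" using y by (simp add: level_R_def)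
  moreover have "(Phi \<circ> Psi) (- y, x) = z" by (simp add: Psi_def xy)
  ultimately show "z \<in> (Phi \<circ> Psi) ` level_R c" by (metis image_eqI)
qed


section \<open>The bounded component\<close>

text \<open>
  The angular momentum is the third component of \<open>\<xi> \<times> \<eta>\<close>, and the third components of the
  orthonormal frame \<open>\<xi>\<close>, \<open>\<eta> / |\<eta>|\<close>, \<open>\<xi> \<times> \<eta> / |\<eta>|\<close> form a unit vector.
\<close>

lemma ang_mom_sq:
  assumes "z \<in> cotangent_S2"
  shows "(ang_mom z)\<^sup>2 = (norm (snd z))\<^sup>2 * (1 - (fst z $ 3)\<^sup>2) - (snd z $ 3)\<^sup>2"
proof -
  note n = cotangent_S2D[OF assms]
  have "(ang_mom z)\<^sup>2 = ((fst z$1)\<^sup>2 + (fst z$2)\<^sup>2) * ((snd z$1)\<^sup>2 + (snd z$2)\<^sup>2)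
      - (fst z$1 * snd z$1 + fst z$2 * snd z$2)\<^sup>2"
    by (simp add: ang_mom_def algebra_simps power2_eq_square)
  also have "(fst z$1)\<^sup>2 + (fst z$2)\<^sup>2 = 1 - (fst z$3)\<^sup>2" using n by simp
  also have "(snd z$1)\<^sup>2 + (snd z$2)\<^sup>2 = (norm (snd z))\<^sup>2 - (snd z$3)\<^sup>2" by (simp add: norm3_sq)
  also have "fst z$1 * snd z$1 + fst z$2 * snd z$2 = - (fst z$3 * snd z$3)" using n by simp
  finally show ?thesis by (simp add: algebra_simps power_mult_distrib)
qed

definition unit_bundle :: "((real^3) \<times> (real^3)) set" where
  "unit_bundle = {u \<in> cotangent_S2. norm (snd u) = 1}"

definition fiber_lin :: "real \<Rightarrow> real^3 \<Rightarrow> real" where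
  "fiber_lin c \<xi> = (1 + \<xi>$3) / 2 + (1 - \<xi>$3) * c"

definition fiber_disc :: "real \<Rightarrow> (real^3) \<times> (real^3) \<Rightarrow> real" where
  "fiber_disc c u = (fiber_lin c (fst u))\<^sup>2 - 4 * (1 - fst u $ 3) * ang_mom u"

text \<open>
  The smallest positive root of \<open>a \<rho>\<^sup>2 - b \<rho> + 1\<close> is written as \<open>2 / (b + sqrt (b\<^sup>2 - 4 a))\<close>, which is smooth also
  where \<open>a\<close> vanishes.  The coefficients are \<open>b = fiber_lin\<close> and \<open>a = (1 - \<xi>\<^sub>3) J\<close>.
\<close>

definition fiber_point :: "real \<Rightarrow> (real^3) \<times> (real^3) \<Rightarrow> (real^3) \<times> (real^3)" where
  "fiber_point c u = (fst u, (2 / (fiber_lin c (fst u) + sqrt (fiber_disc c u))) *\<^sub>R snd u)"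

lemma height_bounds:
  assumes "z \<in> cotangent_S2"
  shows "fst z $ 3 \<le> 1" "- 1 \<le> fst z $ 3"
proof -
  have "(fst z $ 3)\<^sup>2 \<le> 1\<^sup>2" 
    using cotangent_S2D(1)[OF assms] zero_le_power2[of "fst z $ 1"] zero_le_power2[of "fst z $ 2"]
    unfolding one_power2 by linarith
  then show "fst z $ 3 \<le> 1" "- 1 \<le> fst z $ 3" by (auto simp: abs_square_le_1)
qed

lemma fiber_lin_ge_1:
  assumes "c > 3/2" "\<xi>$3 \<le> 1"
  shows "fiber_lin c \<xi> \<ge> 1 + (1 - \<xi>$3)" and "\<xi>$3 < 1 \<Longrightarrow> fiber_lin c \<xi> > 1 + (1 - \<xi>$3)"
proof -
  have eq: "fiber_lin c \<xi> = 1 + (1 - \<xi>$3) + (1 - \<xi>$3) * (c - 3/2)"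
    by (simp add: fiber_lin_def field_simps)
  show "fiber_lin c \<xi> \<ge> 1 + (1 - \<xi>$3)" unfolding eq using assms by simp
  show "fiber_lin c \<xi> > 1 + (1 - \<xi>$3)" if "\<xi>$3 < 1" unfolding eq using assms that by simp
qed

text \<open>
  This is where the critical value enters.  With \<open>s = 1 - \<xi>\<^sub>3\<close>, the bound \<open>c > 3/2\<close> gives \<open>b > 1 + s\<close>
  off the pole, while \<open>a \<le> s\<close> on unit covectors, so that \<open>b\<^sup>2 > (1 + s)\<^sup>2 \<ge> 4 s \<ge> 4 a\<close>.
\<close>

lemma fiber_disc_pos:
  assumes c: "c > 3/2" and u: "u \<in> unit_bundle"
  shows "fiber_disc c u > 0"
proof -
  define s where "s = 1 - fst u $ 3"
  have uc: "u \<in> cotangent_S2" "norm (snd u) = 1" using u by (auto simp: unit_bundle_def)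
  have s: "s \<ge> 0" using height_bounds(1)[OF uc(1)] by (simp add: s_def)
  have "(ang_mom u)\<^sup>2 \<le> 1\<^sup>2" unfolding ang_mom_sq[OF uc(1)] uc(2) by simp
  then have j: "ang_mom u \<le> 1" by (auto simp: abs_square_le_1)
  show ?thesis
  proof (cases "s = 0")
    case True
    then show ?thesis by (simp add: fiber_disc_def fiber_lin_def s_def)
  next
    case False
    then have b: "fiber_lin c (fst u) > 1 + s" using fiber_lin_ge_1(2)[OF c, of "fst u"] s by (simp add: s_def)
    have "4 * s * ang_mom u \<le> 4 * s" using s j by (simp add: mult_left_le)
    also have "\<dots> \<le> (1 + s)\<^sup>2" using zero_le_power2[of "1 - s"] by (simp add: power2_eq_square algebra_simps)
    also have "\<dots> < (fiber_lin c (fst u))\<^sup>2" using b s by (simp add: power_strict_mono)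
    finally show ?thesis by (simp add: fiber_disc_def s_def)
  qed
qed

lemma moser_ham_ray:
  assumes "norm h = 1" "\<rho> \<ge> 0"
  shows "moser_ham c (\<xi>, \<rho> *\<^sub>R h) = fiber_lin c \<xi> * \<rho> - ((1 - \<xi>$3) * ang_mom (\<xi>, h)) * \<rho>\<^sup>2"
    and "orbit_radius (\<xi>, \<rho> *\<^sub>R h) * ang_mom (\<xi>, \<rho> *\<^sub>R h) = ((1 - \<xi>$3) * ang_mom (\<xi>, h)) * \<rho>\<^sup>2"
  using assms
  by (simp_all add: moser_ham_def orbit_radius_def fiber_lin_def ang_mom_def algebra_simps power2_eq_square add_divide_distrib)

lemma smaller_root_iff:
  fixes a b \<rho> :: real
  assumes "b > 0" "b\<^sup>2 - 4 * a > 0"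
  shows "\<rho> > 0 \<and> b * \<rho> - a * \<rho>\<^sup>2 = 1 \<and> a * \<rho>\<^sup>2 < 1 \<longleftrightarrow> \<rho> = 2 / (b + sqrt (b\<^sup>2 - 4 * a))"
proof -
  define D where "D = sqrt (b\<^sup>2 - 4 * a)"
  have D: "D > 0" "D\<^sup>2 = b\<^sup>2 - 4 * a" using assms by (auto simp: D_def)
  show ?thesis
  proof
    assume A: "\<rho> > 0 \<and> b * \<rho> - a * \<rho>\<^sup>2 = 1 \<and> a * \<rho>\<^sup>2 < 1"
    then have "(b - 2 * a * \<rho>) * \<rho> > 0" by (simp add: algebra_simps power2_eq_square)
    then have p: "b - 2 * a * \<rho> > 0" using A by (simp add: zero_less_mult_iff)
    have "(b - 2 * a * \<rho>)\<^sup>2 = b\<^sup>2 - 4 * a * (b * \<rho> - a * \<rho>\<^sup>2)"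
      by (simp add: algebra_simps power2_eq_square)
    also have "\<dots> = D\<^sup>2" using A D by simp
    finally have "b - 2 * a * \<rho> = D" using p D by (metis power2_eq_iff_nonneg less_imp_le)
    then have "(b + D) * \<rho> = 2 * (b * \<rho> - a * \<rho>\<^sup>2)" by (auto simp: algebra_simps power2_eq_square)
    then have "(b + D) * \<rho> = 2" using A by simp
    then show "\<rho> = 2 / (b + sqrt (b\<^sup>2 - 4 * a))" using assms D unfolding D_def[symmetric] by (simp add: field_simps)
  next
    assume "\<rho> = 2 / (b + sqrt (b\<^sup>2 - 4 * a))"
    then have r: "\<rho> = 2 / (b + D)" by (simp add: D_def)
    have bD: "b + D > 0" using assms D by simp
    have a: "a = (b - D) * (b + D) / 4" using D by (simp add: algebra_simps power2_eq_square)
    have ar: "a * \<rho>\<^sup>2 = (b - D) / (b + D)"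
      unfolding a r using bD by (simp add: power2_eq_square)
    have "b * \<rho> - a * \<rho>\<^sup>2 = 1" unfolding ar unfolding r using bD by (simp flip: diff_divide_distrib)
    then show "\<rho> > 0 \<and> b * \<rho> - a * \<rho>\<^sup>2 = 1 \<and> a * \<rho>\<^sup>2 < 1"
      unfolding ar using bD D by (simp add: r field_simps)
  qed
qed

lemma smaller_root_ray_iff:
  assumes c: "c > 3/2" and u: "(\<xi>, h) \<in> unit_bundle"
  shows "\<rho> > 0 \<and> moser_ham c (\<xi>, \<rho> *\<^sub>R h) = 1 \<and> orbit_radius (\<xi>, \<rho> *\<^sub>R h) * ang_mom (\<xi>, \<rho> *\<^sub>R h) < 1
    \<longleftrightarrow> \<rho> = 2 / (fiber_lin c \<xi> + sqrt (fiber_disc c (\<xi>, h)))"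
proof -
  have h: "norm h = 1" and uc: "(\<xi>, h) \<in> cotangent_S2" using u by (auto simp: unit_bundle_def)
  have b: "fiber_lin c \<xi> > 0" using fiber_lin_ge_1(1)[OF c, of \<xi>] height_bounds[OF uc] by simp
  have d: "fiber_disc c (\<xi>, h) = (fiber_lin c \<xi>)\<^sup>2 - 4 * ((1 - \<xi>$3) * ang_mom (\<xi>, h))"
    by (simp add: fiber_disc_def)
  note iff = smaller_root_iff[OF b, of "(1 - \<xi>$3) * ang_mom (\<xi>, h)" \<rho>, folded d, OF fiber_disc_pos[OF c u]]
  show ?thesis
    using iff moser_ham_ray[OF h, of \<rho>] by (metis less_imp_le)
qed

lemma energy_level_covector_nonzero: "z \<in> energy_level c \<Longrightarrow> snd z \<noteq> 0"
  by (auto simp: energy_level_def moser_ham_def)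

lemma unit_bundle_normalize:
  assumes "z \<in> cotangent_S2" "snd z \<noteq> 0"
  shows "(fst z, snd z /\<^sub>R norm (snd z)) \<in> unit_bundle"
  using assms by (auto simp: unit_bundle_def cotangent_S2_def case_prod_beta)

lemma bounded_level_eq_image:
  assumes c: "c > 3/2"
  shows "bounded_level c = fiber_point c ` unit_bundle"
proof (intro equalityI subsetI)
  fix z assume z: "z \<in> bounded_level c"
  define \<rho> h where "\<rho> = norm (snd z)" and "h = snd z /\<^sub>R \<rho>"
  have zc: "z \<in> cotangent_S2" and nz: "snd z \<noteq> 0"
    using z energy_level_covector_nonzero[of z c] by (auto simp: bounded_level_def energy_level_def)
  have u: "(fst z, h) \<in> unit_bundle" unfolding h_def \<rho>_def by (rule unit_bundle_normalize[OF zc nz])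
  have zz: "z = (fst z, \<rho> *\<^sub>R h)" using nz by (simp add: h_def \<rho>_def prod_eq_iff)
  have "\<rho> = 2 / (fiber_lin c (fst z) + sqrt (fiber_disc c (fst z, h)))"
    using z nz unfolding smaller_root_ray_iff[OF c u, symmetric] zz[symmetric]
    by (simp add: bounded_level_def energy_level_def \<rho>_def)
  then have "z = fiber_point c (fst z, h)" using zz by (simp add: fiber_point_def)
  then show "z \<in> fiber_point c ` unit_bundle" using u by blast
next
  fix z assume "z \<in> fiber_point c ` unit_bundle"
  then obtain \<xi> h where u: "(\<xi>, h) \<in> unit_bundle" and z: "z = fiber_point c (\<xi>, h)" by force
  define \<rho> where "\<rho> = 2 / (fiber_lin c \<xi> + sqrt (fiber_disc c (\<xi>, h)))"
  have zz: "z = (\<xi>, \<rho> *\<^sub>R h)" by (simp add: z fiber_point_def \<rho>_def)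
  have "moser_ham c z = 1 \<and> orbit_radius z * ang_mom z < 1"
    using smaller_root_ray_iff[OF c u, of \<rho>] by (simp add: \<rho>_def[symmetric] zz)
  moreover have "z \<in> cotangent_S2" using u by (simp add: zz unit_bundle_def cotangent_S2_def)
  ultimately show "z \<in> bounded_level c" by (simp add: bounded_level_def energy_level_def)
qed

lemma continuous_on_ang_mom: "continuous_on S ang_mom"
  unfolding ang_mom_def by (intro continuous_intros)

lemma continuous_on_moser_ham: "continuous_on S (moser_ham c)"
  unfolding moser_ham_def by (intro continuous_intros continuous_on_ang_mom) auto

lemma continuous_on_orbit_radius: "continuous_on S orbit_radius"
  unfolding orbit_radius_def by (intro continuous_intros)

lemma fiber_denominator_ge_1:
  assumes c: "c > 3/2" and u: "u \<in> unit_bundle"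
  shows "fiber_lin c (fst u) + sqrt (fiber_disc c u) \<ge> 1"
proof -
  have "fiber_lin c (fst u) \<ge> 1"
    using fiber_lin_ge_1(1)[OF c, of "fst u"] height_bounds(1)[of u] u by (simp add: unit_bundle_def)
  then show ?thesis using fiber_disc_pos[OF c u] real_sqrt_ge_zero[of "fiber_disc c u"] by linarith
qed

lemma continuous_on_fiber_point:
  assumes c: "c > 3/2"
  shows "continuous_on unit_bundle (fiber_point c)"
proof -
  have "fiber_lin c (fst u) + sqrt (fiber_disc c u) \<noteq> 0" if "u \<in> unit_bundle" for u
    using fiber_denominator_ge_1[OF c that] by simp
  then show ?thesis
    unfolding fiber_point_def fiber_disc_def fiber_lin_def
    by (intro continuous_intros continuous_on_ang_mom) (auto simp: fiber_disc_def fiber_lin_def)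
qed

lemma bounded_bounded_level:
  assumes c: "c > 3/2"
  shows "bounded (bounded_level c)"
proof -
  have "norm (fiber_point c u) \<le> 3" if u: "u \<in> unit_bundle" for u
  proof -
    have "norm (fiber_point c u) \<le> norm (fst u) + norm ((2 / (fiber_lin c (fst u) + sqrt (fiber_disc c u))) *\<^sub>R snd u)"
      unfolding fiber_point_def by (rule norm_Pair_le)
    also have "\<dots> \<le> 1 + 2"
      using u fiber_denominator_ge_1[OF c u]
      by (intro add_mono) (auto simp: unit_bundle_def cotangent_S2_def field_simps)
    finally show ?thesis by simp
  qed
  then show ?thesis unfolding bounded_level_eq_image[OF c] bounded_iff by blast
qed

text \<open>
  The unit bundle is parametrized by Euler angles: \<open>\<alpha>\<close>, \<open>\<beta>\<close> are spherical coordinates of the base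
  point, and \<open>\<gamma>\<close> is the angle of the unit vector in the orthonormal basis given by the directions
  of increasing \<open>\<beta>\<close> and \<open>\<alpha>\<close>.
\<close>

lemma connected_unit_bundle: "connected unit_bundle"
proof -
  define E :: "real \<times> real \<times> real \<Rightarrow> (real^3) \<times> (real^3)" where "E = (\<lambda>(\<alpha>, \<beta>, \<gamma>).
     ((cos \<alpha> * sin \<beta>) *\<^sub>R axis 1 1 + (sin \<alpha> * sin \<beta>) *\<^sub>R axis 2 1 + cos \<beta> *\<^sub>R axis 3 1,
      (cos \<gamma> * cos \<alpha> * cos \<beta> - sin \<gamma> * sin \<alpha>) *\<^sub>R axis 1 1
       + (cos \<gamma> * sin \<alpha> * cos \<beta> + sin \<gamma> * cos \<alpha>) *\<^sub>R axis 2 1 - (cos \<gamma> * sin \<beta>) *\<^sub>R axis 3 1))"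
  have "continuous_on UNIV E"
    unfolding E_def case_prod_beta by (intro continuous_intros)
  then have conn: "connected (range E)" by (intro connected_continuous_image connected_UNIV)
  have sub: "E p \<in> unit_bundle" for p
  proof -
    obtain \<alpha> \<beta> \<gamma> where p: "p = (\<alpha>, \<beta>, \<gamma>)" using prod_cases3 by blast
    have t: "(sin \<alpha>)\<^sup>2 + (cos \<alpha>)\<^sup>2 = 1" "(sin \<beta>)\<^sup>2 + (cos \<beta>)\<^sup>2 = 1" "(sin \<gamma>)\<^sup>2 + (cos \<gamma>)\<^sup>2 = 1" by simp_all
    have "(cos \<alpha> * sin \<beta>)\<^sup>2 + (sin \<alpha> * sin \<beta>)\<^sup>2 + (cos \<beta>)\<^sup>2 = 1"
      using t by algebra
    then have 1: "(norm (fst (E p)))\<^sup>2 = 1"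
      unfolding norm3_sq by (simp add: p E_def axis_def)
    have "(cos \<gamma> * cos \<alpha> * cos \<beta> - sin \<gamma> * sin \<alpha>)\<^sup>2
        + (cos \<gamma> * sin \<alpha> * cos \<beta> + sin \<gamma> * cos \<alpha>)\<^sup>2 + (cos \<gamma> * sin \<beta>)\<^sup>2 = 1"
      using t by algebra
    then have 2: "(norm (snd (E p)))\<^sup>2 = 1"
      unfolding norm3_sq by (simp add: p E_def axis_def)
    have "(cos \<alpha> * sin \<beta>) * (cos \<gamma> * cos \<alpha> * cos \<beta> - sin \<gamma> * sin \<alpha>)
        + (sin \<alpha> * sin \<beta>) * (cos \<gamma> * sin \<alpha> * cos \<beta> + sin \<gamma> * cos \<alpha>) - cos \<beta> * (cos \<gamma> * sin \<beta>) = 0"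
      using t by algebra
    then have 3: "fst (E p) \<bullet> snd (E p) = 0"
      unfolding inner3 by (simp add: p E_def axis_def)
    have "norm (fst (E p)) = 1" "norm (snd (E p)) = 1"
      using 1 2 by (metis norm_ge_zero power2_eq_iff_nonneg one_power2 zero_le_one)+
    then show ?thesis using 3 by (simp add: unit_bundle_def cotangent_S2_def case_prod_beta)
  qed
  moreover have "\<exists>p. u = E p" if u: "u \<in> unit_bundle" for u
  proof -
    obtain \<xi> h where uu: "u = (\<xi>, h)" by force
    have uc: "u \<in> cotangent_S2" and hn: "norm h = 1" using u by (auto simp: unit_bundle_def uu)
    have n: "(\<xi>$1)\<^sup>2 + (\<xi>$2)\<^sup>2 + (\<xi>$3)\<^sup>2 = 1" and o: "\<xi>$1 * h$1 + \<xi>$2 * h$2 + \<xi>$3 * h$3 = 0"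
      using cotangent_S2D[OF uc] by (simp_all add: uu)
    have m: "(h$1)\<^sup>2 + (h$2)\<^sup>2 + (h$3)\<^sup>2 = 1" using norm3_sq[of h] hn by simp
    have "0 \<le> (\<xi>$1)\<^sup>2 + (\<xi>$2)\<^sup>2" by simp
    then have "(sqrt ((\<xi>$1)\<^sup>2 + (\<xi>$2)\<^sup>2))\<^sup>2 = (\<xi>$1)\<^sup>2 + (\<xi>$2)\<^sup>2" by (rule real_sqrt_pow2)
    then have "(\<xi>$3)\<^sup>2 + (sqrt ((\<xi>$1)\<^sup>2 + (\<xi>$2)\<^sup>2))\<^sup>2 = 1" using n by simp
    then obtain \<beta> where b: "\<xi>$3 = cos \<beta>" "sqrt ((\<xi>$1)\<^sup>2 + (\<xi>$2)\<^sup>2) = sin \<beta>" using sincos_total_2pi by metis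
    have b2: "(\<xi>$1)\<^sup>2 + (\<xi>$2)\<^sup>2 = (sin \<beta>)\<^sup>2" using b(2) by (metis \<open>0 \<le> _\<close> real_sqrt_pow2)
    have "\<exists>\<alpha>. \<xi>$1 = cos \<alpha> * sin \<beta> \<and> \<xi>$2 = sin \<alpha> * sin \<beta>"
    proof (cases "sin \<beta> = 0")
      case True
      then have "\<xi>$1 = 0" "\<xi>$2 = 0" using b2 by (auto simp: sum_power2_eq_zero_iff)
      then show ?thesis using True by simp
    next
      case False
      have "(\<xi>$1 / sin \<beta>)\<^sup>2 + (\<xi>$2 / sin \<beta>)\<^sup>2 = 1"
        using b2 False by (simp add: power_divide flip: add_divide_distrib)
      then obtain \<alpha> where "\<xi>$1 / sin \<beta> = cos \<alpha>" "\<xi>$2 / sin \<beta> = sin \<alpha>" using sincos_total_2pi by metis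
      then show ?thesis using False by (intro exI[of _ \<alpha>]) (simp add: field_simps)
    qed
    then obtain \<alpha> where a: "\<xi>$1 = cos \<alpha> * sin \<beta>" "\<xi>$2 = sin \<alpha> * sin \<beta>" by blast
    \<comment> \<open>The coordinates of \<open>h\<close> in the tangent basis; their squares add up to 1.\<close>
    define A where "A = h$1 * cos \<alpha> * cos \<beta> + h$2 * sin \<alpha> * cos \<beta> - h$3 * sin \<beta>"
    define C where "C = h$2 * cos \<alpha> - h$1 * sin \<alpha>"
    have t: "(sin \<alpha>)\<^sup>2 + (cos \<alpha>)\<^sup>2 = 1" "(sin \<beta>)\<^sup>2 + (cos \<beta>)\<^sup>2 = 1" by simp_all
    have o': "cos \<alpha> * sin \<beta> * h$1 + sin \<alpha> * sin \<beta> * h$2 + cos \<beta> * h$3 = 0" using o by (simp add: a b)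
    have h1: "h$1 = A * cos \<alpha> * cos \<beta> - C * sin \<alpha>" using t o' unfolding A_def C_def by algebra
    have h2: "h$2 = A * sin \<alpha> * cos \<beta> + C * cos \<alpha>" using t o' unfolding A_def C_def by algebra
    have h3: "h$3 = - A * sin \<beta>" using t o' unfolding A_def C_def by algebra
    have "A\<^sup>2 + C\<^sup>2 = 1" using m t h1 h2 h3 by algebra
    then obtain \<gamma> where g: "A = cos \<gamma>" "C = sin \<gamma>" using sincos_total_2pi by metis
    have "u = E (\<alpha>, \<beta>, \<gamma>)"
      unfolding uu E_def using a b h1 h2 h3 g by (simp add: vec3_eq axis_def)
    then show ?thesis by blast
  qed
  ultimately have "range E = unit_bundle" by blast
  then show ?thesis using conn by simp
qed

lemma connected_bounded_level: "c > 3/2 \<Longrightarrow> connected (bounded_level c)"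
  using connected_continuous_image[OF continuous_on_fiber_point connected_unit_bundle]
  by (simp add: bounded_level_eq_image)


lemma closed_energy_level: "closed (energy_level c)"
proof -
  have "closed (cotangent_S2)"
    unfolding cotangent_S2_def case_prod_beta
    by (intro closed_Collect_conj closed_Collect_eq continuous_intros)
  moreover have "closed {z. moser_ham c z = 1}"
    by (intro closed_Collect_eq continuous_on_moser_ham continuous_intros)
  moreover have "energy_level c = cotangent_S2 \<inter> {z. moser_ham c z = 1}" by (auto simp: energy_level_def)
  ultimately show ?thesis by (simp only: closed_Int)
qed

text \<open>
  The points over the north pole are the collisions, at which the momentum is infinite.  Each of
  them is a limit of points of the image: move the base point along the great circle with the
  given initial covector, transport the covector and rescale it to the smallest positive root.
\<close>

lemma closure_image_level:
  assumes c: "c > 3/2"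
  shows "cotangent_S2 \<inter> closure ((Phi \<circ> Psi) ` level_R c) = energy_level c"
proof (intro equalityI subsetI)
  fix z assume "z \<in> cotangent_S2 \<inter> closure ((Phi \<circ> Psi) ` level_R c)"
  moreover have "closure ((Phi \<circ> Psi) ` level_R c) \<subseteq> energy_level c"
    unfolding image_level by (intro closure_minimal closed_energy_level) auto
  ultimately show "z \<in> energy_level c" by blast
next
  fix z assume z: "z \<in> energy_level c"
  then have zc: "z \<in> cotangent_S2" and zm: "moser_ham c z = 1" by (auto simp: energy_level_def)
  have "z \<in> closure {z \<in> energy_level c. fst z $ 3 < 1}"
  proof (cases "fst z $ 3 < 1")
    case True
    then show ?thesis using z by (intro subsetD[OF closure_subset]) simp
  next
    case False
    then have z3: "fst z $ 3 = 1" using height_bounds(1)[OF zc] by simp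
    have sz: "norm (snd z) = 1" using zm by (simp add: moser_ham_def z3)
    have zz: "fst z$1 = 0" "fst z$2 = 0"
      using cotangent_S2D(1)[OF zc] z3 by (auto simp: sum_power2_eq_zero_iff)
    have s3: "snd z$3 = 0" using cotangent_S2D(2)[OF zc] zz z3 by simp
    define u where "u = (\<lambda>t. (cos t *\<^sub>R fst z + sin t *\<^sub>R snd z, cos t *\<^sub>R snd z - sin t *\<^sub>R fst z))"
    have u: "u t \<in> unit_bundle" for t
    proof -
      have i: "fst z \<bullet> fst z = 1" "snd z \<bullet> snd z = 1" "fst z \<bullet> snd z = 0" "snd z \<bullet> fst z = 0"
        using cotangent_S2D[OF zc] sz by (simp_all add: norm_eq_1 inner_commute)
      show ?thesis
        unfolding unit_bundle_def cotangent_S2_def u_def norm_eq_1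
        by (simp add: inner_simps i power2_eq_square[symmetric])
    qed
    have contu: "continuous_on UNIV u" unfolding u_def by (intro continuous_intros)
    have "continuous_on UNIV (\<lambda>t. fiber_point c (u t))"
      using continuous_on_compose2[OF continuous_on_fiber_point[OF c] contu] u by blast
    then have cont: "isCont (\<lambda>t. fiber_point c (u t)) 0"
      by (simp add: continuous_on_eq_continuous_at)
    have u0: "fiber_point c (u 0) = z"
      by (simp add: u_def fiber_point_def fiber_disc_def fiber_lin_def z3)
    have lim: "(\<lambda>n. fiber_point c (u (inverse (real (Suc n))))) \<longlonglongrightarrow> z"
      using isCont_tendsto_compose[OF cont LIMSEQ_inverse_real_of_nat] by (simp only: u0)
    have "fiber_point c (u (inverse (real (Suc n)))) \<in> {z \<in> energy_level c. fst z $ 3 < 1}" for n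
    proof -
      have t: "0 < inverse (real (Suc n))" "inverse (real (Suc n)) \<le> 1" by (auto simp: field_simps)
      then have "cos (inverse (real (Suc n))) < cos 0"
        using pi_gt3 by (intro cos_monotone_0_pi) auto
      then have "fst (fiber_point c (u (inverse (real (Suc n))))) $ 3 < 1"
        by (simp add: fiber_point_def u_def z3 s3)
      moreover have "fiber_point c (u (inverse (real (Suc n)))) \<in> energy_level c"
        using bounded_level_eq_image[OF c] u unfolding bounded_level_def by blast
      ultimately show ?thesis by simp
    qed
    then show ?thesis using lim unfolding closure_sequential by (intro exI conjI allI)
  qed
  then show "z \<in> cotangent_S2 \<inter> closure ((Phi \<circ> Psi) ` level_R c)"
    unfolding image_level using zc by simp
qed

text \<open>
  Both sides are \<open>(b \<rho> - 2 a \<rho>\<^sup>2)\<^sup>2\<close> for a root \<open>\<rho>\<close> of \<open>a \<rho>\<^sup>2 - b \<rho> + 1\<close>: the derivative of a quadratic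
  polynomial at a root squares to the discriminant.
\<close>

lemma energy_level_quadratic:
  assumes "z \<in> energy_level c"
  shows "(1 - orbit_radius z * ang_mom z)\<^sup>2
     = (norm (snd z))\<^sup>2 * fiber_disc c (fst z, snd z /\<^sub>R norm (snd z))"
proof -
  define \<rho> h where "\<rho> = norm (snd z)" and "h = snd z /\<^sub>R \<rho>"
  define a where "a = (1 - fst z $ 3) * ang_mom (fst z, h)"
  have nz: "snd z \<noteq> 0" using energy_level_covector_nonzero[OF assms] .
  then have zz: "z = (fst z, \<rho> *\<^sub>R h)" and h: "norm h = 1" "\<rho> \<ge> 0" by (auto simp: h_def \<rho>_def prod_eq_iff)
  have m: "fiber_lin c (fst z) * \<rho> - a * \<rho>\<^sup>2 = 1" and g: "orbit_radius z * ang_mom z = a * \<rho>\<^sup>2"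
    using moser_ham_ray(1)[OF h, of c "fst z"] moser_ham_ray(2)[OF h, of "fst z"] assms unfolding zz[symmetric] a_def energy_level_def by auto
  have "(1 - a * \<rho>\<^sup>2)\<^sup>2 = (1 + a * \<rho>\<^sup>2)\<^sup>2 - 4 * (a * \<rho>\<^sup>2)" by (simp add: power2_eq_square algebra_simps)
  also have "1 + a * \<rho>\<^sup>2 = fiber_lin c (fst z) * \<rho>" using m by simp
  finally have eq: "(1 - a * \<rho>\<^sup>2)\<^sup>2 = \<rho>\<^sup>2 * ((fiber_lin c (fst z))\<^sup>2 - 4 * a)"
    by (simp only: power_mult_distrib right_diff_distrib mult_ac)
  have "fiber_disc c (fst z, h) = (fiber_lin c (fst z))\<^sup>2 - 4 * a" by (simp add: fiber_disc_def a_def)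
  then show ?thesis using eq unfolding g h_def \<rho>_def by simp
qed

lemma radius_ang_mom_neq_1:
  assumes c: "c > 3/2" and z: "z \<in> energy_level c"
  shows "orbit_radius z * ang_mom z \<noteq> 1"
proof
  assume A: "orbit_radius z * ang_mom z = 1"
  have nz: "snd z \<noteq> 0" and zc: "z \<in> cotangent_S2"
    using energy_level_covector_nonzero[OF z] z by (auto simp: energy_level_def)
  show False
    using energy_level_quadratic[OF z] fiber_disc_pos[OF c unit_bundle_normalize[OF zc nz]] nz A by simp
qed

text \<open>
  The function \<open>orbit_radius * ang_mom\<close> omits the value 1 on the energy level, so the condition that
  it be less than 1 is both open and closed.
\<close>

lemma bounded_level_component:
  assumes c: "c > 3/2"
  shows "bounded_level c \<in> components (energy_level c)"
  unfolding in_components_maximal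
proof (intro conjI allI impI)
  have "(axis 3 1, axis 1 1) \<in> unit_bundle"
    by (simp add: unit_bundle_def cotangent_S2_def inner_axis_axis)
  then show ne: "bounded_level c \<noteq> {}" unfolding bounded_level_eq_image[OF c] by blast
  show "bounded_level c \<subseteq> energy_level c" by (auto simp: bounded_level_def)
  show "connected (bounded_level c)" by (rule connected_bounded_level[OF c])
  fix d assume d: "d \<noteq> {} \<and> bounded_level c \<subseteq> d \<and> d \<subseteq> energy_level c \<and> connected d"
  have cont: "continuous_on d (\<lambda>z. orbit_radius z * ang_mom z)"
    by (intro continuous_intros continuous_on_orbit_radius continuous_on_ang_mom)
  have lt: "bounded_level c = d \<inter> (\<lambda>z. orbit_radius z * ang_mom z) -` {..<1}"
    using d by (auto simp: bounded_level_def)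
  have le: "bounded_level c = d \<inter> (\<lambda>z. orbit_radius z * ang_mom z) -` {..1}"
    using d radius_ang_mom_neq_1[OF c] unfolding lt by (force simp: less_le)
  have "openin (top_of_set d) (bounded_level c)"
    unfolding lt by (rule continuous_openin_preimage_gen[OF cont]) simp
  moreover have "closedin (top_of_set d) (bounded_level c)"
    unfolding le by (rule continuous_closedin_preimage[OF cont]) simp
  ultimately show "d = bounded_level c"
    using d ne unfolding connected_clopen by blast
qed

text \<open>
  At a point \<open>(\<xi>, \<eta>)\<close> of the larger root \<open>J\<close> is positive.  Keep \<open>\<xi>\<close> and turn the direction \<open>w t\<close> of
  the covector from \<open>\<eta>\<close> towards the direction \<open>u\<close> of the north pole, where \<open>J\<close> vanishes.  The
  leading coefficient of the quadratic equation for the length then tends to 0 through positive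
  values, so that its larger root escapes to infinity.
\<close>

lemma unbounded_path:
  assumes c: "c > 3/2" and z: "z \<in> energy_level c" and g: "orbit_radius z * ang_mom z > 1"
  shows "\<exists>D. connected D \<and> z \<in> D \<and> D \<subseteq> energy_level c \<and> \<not> bounded D"
proof -
  obtain \<xi> \<eta> where ze: "z = (\<xi>, \<eta>)" by force
  define s where "s = 1 - \<xi>$3"
  define b where "b = fiber_lin c \<xi>"
  define j where "j = ang_mom z"
  define u where "u = axis 3 1 - (\<xi>$3) *\<^sub>R \<xi>"
  define w where "w = (\<lambda>t. (1 - t) *\<^sub>R \<eta> + t *\<^sub>R u)"
  define A where "A = (\<lambda>t. s * ((1 - t) * j) * norm (w t))"
  define B where "B = (\<lambda>t. b * norm (w t))"
  define \<sigma> where "\<sigma> = (\<lambda>t. (B t + sqrt ((B t)\<^sup>2 - 4 * A t)) / (2 * A t))"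
  define P where "P = (\<lambda>t. (\<xi>, \<sigma> t *\<^sub>R w t))"
  have zc: "z \<in> cotangent_S2" and zm: "moser_ham c z = 1" using z by (auto simp: energy_level_def)
  have "orbit_radius z \<ge> 0" using height_bounds[OF zc] by (simp add: orbit_radius_def)
  moreover have "orbit_radius z * ang_mom z > 0" using g by simp
  ultimately have rp: "orbit_radius z > 0" and j: "j > 0"
    by (auto simp: j_def zero_less_mult_iff)
  have s: "s > 0" using rp by (auto simp: orbit_radius_def s_def ze zero_less_mult_iff)
  have n: "(\<xi>$1)\<^sup>2 + (\<xi>$2)\<^sup>2 + (\<xi>$3)\<^sup>2 = 1" and o: "\<xi> \<bullet> \<eta> = 0" and nn: "\<xi> \<bullet> \<xi> = 1"
    using cotangent_S2D[OF zc] by (simp_all add: ze)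
  have b: "b > 1 + s" "b > 0"
    using fiber_lin_ge_1(2)[OF c, of \<xi>] height_bounds[OF zc] s by (auto simp: b_def s_def ze)
  have aw: "ang_mom (\<xi>, x *\<^sub>R w t) = x * (1 - t) * j" for t x
    by (simp add: ang_mom_def w_def u_def axis_def j_def ze algebra_simps)
  have ow: "\<xi> \<bullet> w t = 0" for t
    using n by (simp add: w_def u_def inner_simps o nn inner_axis)
  have w0: "w t \<noteq> 0" if "t < 1" for t
  proof
    assume "w t = 0"
    then show False using aw[of 1 t] j that by (simp add: ang_mom_def)
  qed
  have A: "A t > 0" if "t < 1" for t using w0[OF that] that s j by (simp add: A_def)
  have B: "B t > 0" if "t < 1" for t using w0[OF that] b by (simp add: B_def)
  have D: "(B t)\<^sup>2 - 4 * A t > 0" if "t < 1" for t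
  proof -
    have "(\<xi>, w t /\<^sub>R norm (w t)) \<in> unit_bundle"
      using unit_bundle_normalize[of "(\<xi>, w t)"] w0[OF that] ow zc by (simp add: cotangent_S2_def ze)
    from fiber_disc_pos[OF c this]
    have "b\<^sup>2 - 4 * s * (inverse (norm (w t)) * (1 - t) * j) > 0"
      by (simp add: fiber_disc_def b_def s_def aw)
    then have "(norm (w t))\<^sup>2 * (b\<^sup>2 - 4 * s * (inverse (norm (w t)) * (1 - t) * j)) > 0"
      using w0[OF that] by simp
    moreover have "W\<^sup>2 * (b\<^sup>2 - 4 * s * (inverse W * (1 - t) * j)) = (b * W)\<^sup>2 - 4 * (s * ((1 - t) * j) * W)"
      if "W \<noteq> 0" for W
      using that by (simp add: right_diff_distrib power2_eq_square)
    ultimately show ?thesis using w0[OF that] by (simp add: A_def B_def)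
  qed
  have \<sigma>: "A t * (\<sigma> t)\<^sup>2 - B t * \<sigma> t + 1 = 0" "\<sigma> t > 0" if t: "t < 1" for t
  proof -
    define E where "E = sqrt ((B t)\<^sup>2 - 4 * A t)"
    have E: "E\<^sup>2 = (B t)\<^sup>2 - 4 * A t" "E > 0" using D[OF t] by (auto simp: E_def)
    have sg: "2 * A t * \<sigma> t = B t + E" using A[OF t] by (simp add: \<sigma>_def E_def)
    have "4 * A t * (A t * (\<sigma> t)\<^sup>2 - B t * \<sigma> t + 1) = (2 * A t * \<sigma> t)\<^sup>2 - 2 * B t * (2 * A t * \<sigma> t) + 4 * A t"
      by (simp add: algebra_simps power2_eq_square)
    also have "\<dots> = 0" unfolding sg using E by (simp add: algebra_simps power2_eq_square)
    finally show "A t * (\<sigma> t)\<^sup>2 - B t * \<sigma> t + 1 = 0" using A[OF t] by simp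
    have "2 * A t * \<sigma> t > 0" unfolding sg using B[OF t] E by simp
    then show "\<sigma> t > 0" using A[OF t] by (simp add: zero_less_mult_iff)
  qed
  have PS: "P t \<in> energy_level c" if t: "t < 1" for t
  proof -
    have "moser_ham c (P t) = B t * \<sigma> t - A t * (\<sigma> t)\<^sup>2"
      using \<sigma>(2)[OF t]
      by (simp add: moser_ham_def P_def aw A_def B_def b_def fiber_lin_def s_def algebra_simps power2_eq_square add_divide_distrib)
    then have "moser_ham c (P t) = 1" using \<sigma>(1)[OF t] by simp
    then show ?thesis using ow zc by (simp add: energy_level_def cotangent_S2_def P_def ze)
  qed
  have "continuous_on {..<1} P"
    unfolding P_def \<sigma>_def A_def B_def w_def
    using A unfolding A_def w_def by (intro continuous_intros) (force dest: less_imp_neq)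
  then have conn: "connected (P ` {0..<1})"
    by (intro connected_continuous_image) (auto intro: continuous_on_subset)
  have P0: "P 0 = z"
  proof -
    have Ag: "A 0 = orbit_radius z * ang_mom z" by (simp add: A_def orbit_radius_def w_def s_def j_def ze)
    have "B 0 = 1 + A 0"
      using zm by (simp add: A_def B_def b_def fiber_lin_def w_def s_def j_def ze moser_ham_def algebra_simps add_divide_distrib)
    then have "(B 0)\<^sup>2 - 4 * A 0 = (A 0 - 1)\<^sup>2" by (simp add: power2_eq_square algebra_simps)
    then have "sqrt ((B 0)\<^sup>2 - 4 * A 0) = A 0 - 1" using g by (simp add: Ag)
    then have "\<sigma> 0 = 1" using \<open>B 0 = 1 + A 0\<close> A[of 0] by (simp add: \<sigma>_def)
    then show ?thesis by (simp add: P_def w_def ze)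
  qed
  have "\<not> bounded (P ` {0..<1})"
  proof
    assume "bounded (P ` {0..<1})"
    then obtain M where M: "\<And>t. 0 \<le> t \<Longrightarrow> t < 1 \<Longrightarrow> norm (P t) \<le> M" unfolding bounded_iff by force
    define U where "U = norm u"
    define K where "K = norm \<eta> + s * j * M\<^sup>2"
    have U: "U > 0"
    proof -
      have "u \<noteq> 0"
      proof
        assume u0: "u = 0"
        have "\<xi>$3 * \<xi>$1 = 0" "\<xi>$3 * \<xi>$2 = 0" "\<xi>$3 * \<xi>$3 = 1"
          using u0 by (auto simp: u_def vec3_eq axis_def)
        then have "\<xi>$1 = 0" "\<xi>$2 = 0" by auto
        then show False using j by (simp add: j_def ang_mom_def ze)
      qed
      then show ?thesis by (simp add: U_def)
    qed
    have K: "K \<ge> 0" using s j by (simp add: K_def)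
    \<comment> \<open>A bound on the path would force \<open>w t\<close> to tend to 0 as \<open>t\<close> tends to 1, but its limit is \<open>u \<noteq> 0\<close>.\<close>
    have key: "t * U \<le> (1 - t) * K" if t: "0 \<le> t" "t < 1" for t
    proof -
      have M1: "\<sigma> t * norm (w t) \<le> M"
      proof -
        have "norm (\<sigma> t *\<^sub>R w t) \<le> norm (P t)" unfolding P_def using norm_snd_le[of "\<sigma> t *\<^sub>R w t" \<xi>] by simp
        then show ?thesis using M[OF t] \<sigma>(2)[OF t(2)] by simp
      qed
      \<comment> \<open>This is where the choice of the larger root enters.\<close>
      have ge: "A t * (\<sigma> t)\<^sup>2 \<ge> 1"
      proof -
        define E where "E = sqrt ((B t)\<^sup>2 - 4 * A t)"
        have E: "E > 0" using D[OF t(2)] by (auto simp: E_def)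
        have sg: "2 * A t * \<sigma> t = B t + E" using A[OF t(2)] by (simp add: \<sigma>_def E_def)
        have "2 * A t * \<sigma> t * \<sigma> t \<ge> B t * \<sigma> t" using \<sigma>(2)[OF t(2)] E unfolding sg by simp
        then show ?thesis using \<sigma>(1)[OF t(2)] by (simp add: power2_eq_square)
      qed
      have "norm (w t) \<le> norm (w t) * (A t * (\<sigma> t)\<^sup>2)" using ge by (simp add: mult_le_cancel_left1)
      also have "\<dots> = s * j * (1 - t) * (\<sigma> t * norm (w t))\<^sup>2" by (simp add: A_def power2_eq_square)
      also have "\<dots> \<le> s * j * (1 - t) * M\<^sup>2"
        using M1 \<sigma>(2)[OF t(2)] s j t by (intro mult_left_mono power_mono) auto
      finally have 1: "norm (w t) \<le> (1 - t) * (s * j * M\<^sup>2)" by (simp add: algebra_simps)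
      have "t * U = norm (w t - (1 - t) *\<^sub>R \<eta>)" using t by (simp add: w_def U_def)
      also have "\<dots> \<le> norm (w t) + (1 - t) * norm \<eta>"
        using norm_triangle_ineq4[of "w t" "(1 - t) *\<^sub>R \<eta>"] t by simp
      finally show ?thesis using 1 by (simp add: K_def algebra_simps)
    qed
    \<comment> \<open>Any \<open>t < 1\<close> close enough to 1 contradicts \<open>key\<close>; this one does so for all \<open>K \<ge> 0\<close> and \<open>U > 0\<close>.\<close>
    define t where "t = (K + 1) / (K + 1 + U)"
    have "0 \<le> t" "t < 1" using K U by (auto simp: t_def field_simps)
    moreover have "t * U > (1 - t) * K" using K U by (simp add: t_def field_simps add_pos_nonneg)
    ultimately show False using key[of t] by simp
  qed
  moreover have "z \<in> P ` {0..<1}" using P0 by (auto intro!: image_eqI[of _ _ 0])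
  moreover have "P ` {0..<1} \<subseteq> energy_level c" using PS by auto
  ultimately show ?thesis using conn by blast
qed

lemma Sigma_R_eq:
  assumes c: "c > 3/2"
  shows "Sigma_R c = bounded_level c"
  unfolding Sigma_R_def closure_image_level[OF c]
proof (rule the_equality)
  show "bounded_level c \<in> components (energy_level c) \<and> bounded (bounded_level c)"
    using bounded_level_component[OF c] bounded_bounded_level[OF c] by simp
next
  fix C assume C: "C \<in> components (energy_level c) \<and> bounded C"
  show "C = bounded_level c"
  proof (rule ccontr)
    assume "C \<noteq> bounded_level c"
    then have dis: "C \<inter> bounded_level c = {}"
      using C components_nonoverlap[OF _ bounded_level_component[OF c], of C] by blast
    obtain z where zC: "z \<in> C" using C in_components_nonempty by blast
    have z: "z \<in> energy_level c" using C zC in_components_subset by blast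
    have "orbit_radius z * ang_mom z > 1"
      using dis zC z radius_ang_mom_neq_1[OF c z] by (auto simp: bounded_level_def)
    then obtain D where D: "connected D" "z \<in> D" "D \<subseteq> energy_level c" "\<not> bounded D"
      using unbounded_path[OF c z] by blast
    then have "D \<subseteq> C" using components_maximal[of C "energy_level c" D] C zC by blast
    then show False using C D(4) bounded_subset by blast
  qed
qed


section \<open>The Reeb vector field\<close>

lemma has_real_derivative_components:
  fixes \<gamma> :: "real \<Rightarrow> (real^'a) \<times> (real^'a)"
  assumes "(\<gamma> has_vector_derivative v) (at t)"
  shows "((\<lambda>t. fst (\<gamma> t) $ i) has_real_derivative fst v $ i) (at t)"
    and "((\<lambda>t. snd (\<gamma> t) $ i) has_real_derivative snd v $ i) (at t)"
proof -
  have "bounded_linear (\<lambda>z :: (real^'a) \<times> (real^'a). fst z $ i)"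
    by (intro bounded_linear_compose[OF bounded_linear_vec_nth] bounded_linear_fst)
  from bounded_linear.has_vector_derivative[OF this assms]
  show "((\<lambda>t. fst (\<gamma> t) $ i) has_real_derivative fst v $ i) (at t)"
    by (simp add: has_real_derivative_iff_has_vector_derivative)
next
  have "bounded_linear (\<lambda>z :: (real^'a) \<times> (real^'a). snd z $ i)"
    by (intro bounded_linear_compose[OF bounded_linear_vec_nth] bounded_linear_snd)
  from bounded_linear.has_vector_derivative[OF this assms]
  show "((\<lambda>t. snd (\<gamma> t) $ i) has_real_derivative snd v $ i) (at t)"
    by (simp add: has_real_derivative_iff_has_vector_derivative)
qed

lemma has_real_derivative_norm_snd:
  fixes \<gamma> :: "real \<Rightarrow> (real^3) \<times> (real^3)"
  assumes v: "(\<gamma> has_vector_derivative v) (at t)" and nz: "snd (\<gamma> t) \<noteq> 0"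
  shows "((\<lambda>t. norm (snd (\<gamma> t))) has_real_derivative (snd (\<gamma> t) \<bullet> snd v) / norm (snd (\<gamma> t))) (at t)"
proof -
  note d = has_real_derivative_components(2)[OF v]
  have eq: "norm x = sqrt (x$1 * x$1 + x$2 * x$2 + x$3 * x$3)" for x :: "real^3"
    by (simp add: norm_eq_sqrt_inner inner3)
  have p: "snd (\<gamma> t)$1 * snd (\<gamma> t)$1 + snd (\<gamma> t)$2 * snd (\<gamma> t)$2 + snd (\<gamma> t)$3 * snd (\<gamma> t)$3 > 0"
    using nz by (metis inner3 inner_gt_zero_iff)
  have "((\<lambda>t. snd (\<gamma> t)$1 * snd (\<gamma> t)$1 + snd (\<gamma> t)$2 * snd (\<gamma> t)$2 + snd (\<gamma> t)$3 * snd (\<gamma> t)$3)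
      has_real_derivative 2 * (snd (\<gamma> t) \<bullet> snd v)) (at t)"
    by (rule derivative_eq_intros d refl)+ (simp add: inner3)
  from DERIV_chain2[OF DERIV_real_sqrt[OF p] this] show ?thesis
    unfolding eq by (simp add: field_simps)
qed

definition ang_mom_deriv :: "(real^3) \<times> (real^3) \<Rightarrow> (real^3) \<times> (real^3) \<Rightarrow> real" where
  "ang_mom_deriv z v = fst v$1 * snd z$2 + fst z$1 * snd v$2 - fst v$2 * snd z$1 - fst z$2 * snd v$1"

lemma has_real_derivative_ang_mom:
  assumes v: "(\<gamma> has_vector_derivative v) (at t)"
  shows "((\<lambda>t. ang_mom (\<gamma> t)) has_real_derivative ang_mom_deriv (\<gamma> t) v) (at t)"
  unfolding ang_mom_def
  by (rule derivative_eq_intros has_real_derivative_components[OF v] refl)+ (simp add: ang_mom_deriv_def)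

text \<open>
  The linearization at \<open>z\<close> of the equations \<open>|\<xi>|\<^sup>2 = 1\<close>, \<open>\<xi> \<bullet> \<eta> = 0\<close> and \<open>moser_ham c z = 1\<close>.  In the last
  one the second factor of \<open>moser_ham\<close> is replaced by its value \<open>1 / |\<eta>|\<close> on the level.
\<close>

definition level_tangent :: "real \<Rightarrow> (real^3) \<times> (real^3) \<Rightarrow> (real^3) \<times> (real^3) \<Rightarrow> bool" where
  "level_tangent c z v \<longleftrightarrow> fst z \<bullet> fst v = 0 \<and> fst z \<bullet> snd v + snd z \<bullet> fst v = 0 \<and>
     (snd z \<bullet> snd v) / (norm (snd z))\<^sup>2 - norm (snd z) * (c - ang_mom z - 1/2) * fst v $ 3
       - orbit_radius z * ang_mom_deriv z v = 0"

lemma energy_level_bracket: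
  assumes "z \<in> energy_level c"
  shows "(1 + fst z $ 3) / 2 + (1 - fst z $ 3) * (c - ang_mom z) = 1 / norm (snd z)"
  using assms energy_level_covector_nonzero[OF assms]
  by (simp add: energy_level_def moser_ham_def field_simps)

lemma tangent_space_level_tangent:
  assumes "v \<in> tangent_space (bounded_level c) z"
  shows "level_tangent c z v"
proof -
  obtain \<gamma> e where e: "e > 0" "\<And>t. t \<in> {-e<..<e} \<Longrightarrow> \<gamma> t \<in> bounded_level c" and g0: "\<gamma> 0 = z"
    and dv: "(\<gamma> has_vector_derivative v) (at 0)"
    using assms unfolding tangent_space_def by blast
  have zl: "z \<in> energy_level c" using e(2)[of 0] e(1) g0 by (auto simp: bounded_level_def)
  note nz = energy_level_covector_nonzero[OF zl]
  note d = has_real_derivative_components[OF dv]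
  have const: "D = 0" if f: "(f has_real_derivative D) (at 0)"
    and k: "\<And>t. t \<in> {-e<..<e} \<Longrightarrow> f t = k" for f :: "real \<Rightarrow> real" and D k
  proof -
    have "((\<lambda>_. k) has_real_derivative D) (at 0)"
      by (rule has_field_derivative_transform_within_open[OF f, of "{-e<..<e}"]) (use e(1) k in auto)
    then show "D = 0" using DERIV_unique DERIV_const by blast
  qed
  have lev: "\<gamma> t \<in> cotangent_S2" "moser_ham c (\<gamma> t) = 1" if "t \<in> {-e<..<e}" for t
    using e(2)[OF that] by (auto simp: bounded_level_def energy_level_def)
  have "((\<lambda>t. fst (\<gamma> t) $ 1 * fst (\<gamma> t) $ 1 + fst (\<gamma> t) $ 2 * fst (\<gamma> t) $ 2 + fst (\<gamma> t) $ 3 * fst (\<gamma> t) $ 3)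
      has_real_derivative 2 * (fst z \<bullet> fst v)) (at 0)"
    by (rule derivative_eq_intros d refl)+ (simp add: g0 inner3)
  from const[OF this, of 1] have 1: "fst z \<bullet> fst v = 0"
    using cotangent_S2D(1)[OF lev(1)] by (simp add: power2_eq_square)
  have "((\<lambda>t. fst (\<gamma> t) $ 1 * snd (\<gamma> t) $ 1 + fst (\<gamma> t) $ 2 * snd (\<gamma> t) $ 2 + fst (\<gamma> t) $ 3 * snd (\<gamma> t) $ 3)
      has_real_derivative (fst z \<bullet> snd v + snd z \<bullet> fst v)) (at 0)"
    by (rule derivative_eq_intros d refl)+ (simp add: g0 inner3)
  from const[OF this, of 0] have 2: "fst z \<bullet> snd v + snd z \<bullet> fst v = 0"
    using cotangent_S2D(2)[OF lev(1)] by simp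
  have "((\<lambda>t. moser_ham c (\<gamma> t)) has_real_derivative
      (snd z \<bullet> snd v) / norm (snd z) * ((1 + fst z $ 3) / 2 + (1 - fst z $ 3) * (c - ang_mom z))
      + norm (snd z) * (fst v $ 3 / 2 - fst v $ 3 * (c - ang_mom z) - (1 - fst z $ 3) * ang_mom_deriv z v)) (at 0)"
    unfolding moser_ham_def using nz
    by (auto intro!: derivative_eq_intros d has_real_derivative_norm_snd[OF dv]
         has_real_derivative_ang_mom[OF dv] simp: g0)
  from const[OF this, of 1] lev(2)
  have 3: "(snd z \<bullet> snd v) / norm (snd z) * (1 / norm (snd z))
      + norm (snd z) * (fst v $ 3 / 2 - fst v $ 3 * (c - ang_mom z) - (1 - fst z $ 3) * ang_mom_deriv z v) = 0"
    unfolding energy_level_bracket[OF zl] by blast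
  then show ?thesis
    using 1 2 by (simp add: level_tangent_def orbit_radius_def power2_eq_square algebra_simps)
qed

lemma ext_deriv_lambda_can: "ext_deriv lambda_can z v w = snd v \<bullet> fst w - snd w \<bullet> fst v"
proof -
  have "((\<lambda>u. lambda_can u w) has_derivative (\<lambda>v. snd v \<bullet> fst w)) (at z)" for w
    unfolding lambda_can_def by (auto intro!: derivative_eq_intros)
  then have "frechet_derivative (\<lambda>u. lambda_can u w) (at z) = (\<lambda>v. snd v \<bullet> fst w)" for w
    using frechet_derivative_at by metis
  then show ?thesis by (simp add: ext_deriv_def)
qed

text \<open>
  On the level, the Hamiltonian vector field of \<open>moser_ham\<close> on \<open>T\<^sup>*S\<^sup>2\<close>: the components are the partial gradients
  with respect to \<open>\<eta>\<close> and, with a minus sign, to \<open>\<xi>\<close>, and the multiple of \<open>\<xi>\<close> is the Lagrange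
  multiplier that keeps \<open>\<xi> \<bullet> \<eta>\<close> constant.
\<close>

definition ham_field :: "real \<Rightarrow> (real^3) \<times> (real^3) \<Rightarrow> (real^3) \<times> (real^3)" where
  "ham_field c z =
     ((1 / (norm (snd z))\<^sup>2) *\<^sub>R snd z - orbit_radius z *\<^sub>R cross3 (axis 3 1) (fst z),
      (norm (snd z) * (c - ang_mom z - 1/2)) *\<^sub>R axis 3 1 - orbit_radius z *\<^sub>R cross3 (axis 3 1) (snd z)
        - (1 + norm (snd z) * (c - ang_mom z - 1/2) * fst z $ 3) *\<^sub>R fst z)"

definition reeb_field :: "real \<Rightarrow> (real^3) \<times> (real^3) \<Rightarrow> (real^3) \<times> (real^3)" where
  "reeb_field c z = (1 / (1 - orbit_radius z * ang_mom z)) *\<^sub>R ham_field c z"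

lemma ham_field_nth:
  "fst (ham_field c z) $ 1 = snd z $ 1 / (norm (snd z))\<^sup>2 + orbit_radius z * fst z $ 2"
  "fst (ham_field c z) $ 2 = snd z $ 2 / (norm (snd z))\<^sup>2 - orbit_radius z * fst z $ 1"
  "fst (ham_field c z) $ 3 = snd z $ 3 / (norm (snd z))\<^sup>2"
  "snd (ham_field c z) $ 1 = orbit_radius z * snd z $ 2
     - (1 + norm (snd z) * (c - ang_mom z - 1/2) * fst z $ 3) * fst z $ 1"
  "snd (ham_field c z) $ 2 = - orbit_radius z * snd z $ 1
     - (1 + norm (snd z) * (c - ang_mom z - 1/2) * fst z $ 3) * fst z $ 2"
  "snd (ham_field c z) $ 3 = norm (snd z) * (c - ang_mom z - 1/2)
     - (1 + norm (snd z) * (c - ang_mom z - 1/2) * fst z $ 3) * fst z $ 3"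
  by (simp_all add: ham_field_def cross_components axis_def)

lemma ham_field_lambda_can:
  assumes "z \<in> energy_level c"
  shows "lambda_can z (ham_field c z) = 1 - orbit_radius z * ang_mom z"
proof -
  have "norm (snd z) \<noteq> 0" using energy_level_covector_nonzero[OF assms] by simp
  moreover have "snd z \<bullet> cross3 (axis 3 1) (fst z) = ang_mom z"
    by (simp add: inner3 cross_components axis_def ang_mom_def algebra_simps)
  ultimately show ?thesis
    by (simp add: lambda_can_def ham_field_def inner_simps flip: power2_norm_eq_inner)
qed

lemma inner_snd_ham_field:
  assumes "z \<in> cotangent_S2"
  shows "snd z \<bullet> snd (ham_field c z) = norm (snd z) * (c - ang_mom z - 1/2) * snd z $ 3"
proof -
  define m where "m = c - ang_mom z - 1/2"
  have "snd z \<bullet> fst z = 0" using cotangent_S2D(4)[OF assms] by (simp add: inner_commute)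
  then show ?thesis
    by (simp add: ham_field_def inner_simps dot_cross_self flip: m_def) (simp add: inner3 axis_def)
qed

lemma level_tangent_ham_field:
  assumes z: "z \<in> energy_level c"
  shows "level_tangent c z (ham_field c z)"
proof -
  have zc: "z \<in> cotangent_S2" using z by (auto simp: energy_level_def)
  note n = cotangent_S2D[OF zc]
  define m where "m = c - ang_mom z - 1/2"
  have a: "snd z \<bullet> fst (ham_field c z) = 1 - orbit_radius z * ang_mom z"
    using ham_field_lambda_can[OF z] by (simp add: lambda_can_def)
  have b: "fst z \<bullet> snd (ham_field c z) = - 1 + orbit_radius z * ang_mom z"
    using n(3) by (simp add: ham_field_def inner_simps dot_cross_self flip: m_def)
      (simp add: inner3 cross_components axis_def ang_mom_def algebra_simps)
  have 1: "fst z \<bullet> fst (ham_field c z) = 0"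
    by (simp add: ham_field_def inner_simps n dot_cross_self)
  have 2: "snd z \<bullet> snd (ham_field c z) = norm (snd z) * m * snd z $ 3"
    using inner_snd_ham_field[OF zc] by (simp only: m_def)
  have 3: "ang_mom_deriv z (ham_field c z) = 0"
    by (simp add: ang_mom_deriv_def ham_field_nth algebra_simps)
  show ?thesis unfolding level_tangent_def using 1 2 3 a b by (simp add: ham_field_nth flip: m_def)
qed

text \<open>
  Contracting \<open>d\<lambda>\<close> with the Hamiltonian field gives minus the differential of \<open>moser_ham\<close>, up to a
  multiple of \<open>\<xi> \<bullet> d\<xi>\<close>; both vanish on tangent vectors.
\<close>

lemma ext_deriv_ham_field:
  assumes w: "level_tangent c z w"
  shows "ext_deriv lambda_can z (ham_field c z) w = 0"
proof -
  define m where "m = c - ang_mom z - 1/2"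
  have "ext_deriv lambda_can z (ham_field c z) w = norm (snd z) * m * fst w $ 3
      - (snd z \<bullet> snd w) / (norm (snd z))\<^sup>2 + orbit_radius z * ang_mom_deriv z w
      - (1 + norm (snd z) * m * fst z $ 3) * (fst z \<bullet> fst w)"
    unfolding ext_deriv_lambda_can inner3 ham_field_nth ang_mom_deriv_def m_def[symmetric]
    by (simp add: algebra_simps add_divide_distrib)
  then show ?thesis using w by (simp add: level_tangent_def flip: m_def)
qed

lemma level_tangent_diff_scaleR:
  assumes "level_tangent c z v" "level_tangent c z w"
  shows "level_tangent c z (v - k *\<^sub>R w)"
proof -
  have "ang_mom_deriv z (v - k *\<^sub>R w) = ang_mom_deriv z v - k * ang_mom_deriv z w"
    by (simp add: ang_mom_deriv_def algebra_simps)
  then show ?thesis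
    using assms unfolding level_tangent_def
    by (simp add: inner_simps diff_divide_distrib) algebra
qed

lemma orthonormal_frame_zero:
  assumes "norm \<xi> = 1" "norm h = 1" "\<xi> \<bullet> h = 0" "v \<bullet> \<xi> = 0" "v \<bullet> h = 0" "v \<bullet> cross3 \<xi> h = 0"
  shows "v = 0"
proof -
  have "(norm (cross3 \<xi> h))\<^sup>2 = 1" using norm_cross_dot[of \<xi> h] assms by simp
  moreover have "cross3 v (cross3 \<xi> h) = 0" using Lagrange[of v \<xi> h] assms by simp
  then have "(norm v * norm (cross3 \<xi> h))\<^sup>2 = 0"
    using norm_cross_dot[of v "cross3 \<xi> h"] assms by simp
  ultimately show ?thesis by auto
qed

text \<open>
  As tangent vectors are velocities of curves inside the level, test vectors need explicit curves.
  The smallest positive root lifts every differentiable curve in the unit bundle to the level, and the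
  derivative of the root only adds a radial term.
\<close>

lemma tangent_space_frame_curve:
  assumes c: "c > 3/2" and u: "\<And>t. (\<xi> t, h t) \<in> unit_bundle" and z: "z = fiber_point c (\<xi> 0, h 0)"
    and d\<xi>: "(\<xi> has_vector_derivative \<xi>') (at 0)" and dh: "(h has_vector_derivative h') (at 0)"
  shows "\<exists>k. (\<xi>', norm (snd z) *\<^sub>R h' + k *\<^sub>R h 0) \<in> tangent_space (bounded_level c) z"
proof -
  define \<rho> where "\<rho> = (\<lambda>t. 2 / (fiber_lin c (\<xi> t) + sqrt (fiber_disc c (\<xi> t, h t))))"
  have den: "fiber_lin c (\<xi> 0) + sqrt (fiber_disc c (\<xi> 0, h 0)) \<ge> 1"
    using fiber_denominator_ge_1[OF c u[of 0]] by simp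
  have dp: "fiber_disc c (\<xi> 0, h 0) > 0" by (rule fiber_disc_pos[OF c u])
  have du: "((\<lambda>t. (\<xi> t, h t)) has_vector_derivative (\<xi>', h')) (at 0)"
    by (intro has_vector_derivative_Pair d\<xi> dh)
  note d = has_real_derivative_components[OF du, simplified]
  have "\<exists>D1. ((\<lambda>t. fiber_lin c (\<xi> t)) has_real_derivative D1) (at 0)"
    unfolding fiber_lin_def by (rule exI, (rule derivative_eq_intros d refl | simp)+)
  then obtain D1 where D1: "((\<lambda>t. fiber_lin c (\<xi> t)) has_real_derivative D1) (at 0)" ..
  have "\<exists>D2. ((\<lambda>t. fiber_disc c (\<xi> t, h t)) has_real_derivative D2) (at 0)"
    unfolding fiber_disc_def fst_conv
    by (rule exI, (rule derivative_eq_intros d D1 has_real_derivative_ang_mom[OF du] refl)+)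
  then obtain D2 where D2: "((\<lambda>t. fiber_disc c (\<xi> t, h t)) has_real_derivative D2) (at 0)" ..
  have "\<exists>D. (\<rho> has_real_derivative D) (at 0)"
    unfolding \<rho>_def
    by (rule exI, rule DERIV_divide[OF DERIV_const DERIV_add[OF D1 DERIV_chain2[OF DERIV_real_sqrt[OF dp] D2]]])
       (use den in auto)
  then obtain D where D: "(\<rho> has_real_derivative D) (at 0)" ..
  define \<gamma> where "\<gamma> = (\<lambda>t. (\<xi> t, \<rho> t *\<^sub>R h t))"
  have d\<gamma>: "(\<gamma> has_vector_derivative (\<xi>', \<rho> 0 *\<^sub>R h' + D *\<^sub>R h 0)) (at 0)"
    unfolding \<gamma>_def by (intro has_vector_derivative_Pair d\<xi> has_vector_derivative_scaleR[OF D dh])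
  have \<gamma>t: "\<gamma> t = fiber_point c (\<xi> t, h t)" for t by (simp add: \<gamma>_def fiber_point_def \<rho>_def)
  have "\<gamma> t \<in> bounded_level c" for t
    unfolding bounded_level_eq_image[OF c] \<gamma>t using u by (rule imageI)
  moreover have "\<gamma> 0 = z" by (simp add: z \<gamma>t)
  moreover have "\<rho> 0 = norm (snd z)"
    using den u[of 0] by (simp add: z fiber_point_def \<rho>_def unit_bundle_def)
  ultimately have "(\<xi>', norm (snd z) *\<^sub>R h' + D *\<^sub>R h 0) \<in> tangent_space (bounded_level c) z"
    using d\<gamma> unfolding tangent_space_def mem_Collect_eq
    by (intro exI[of _ \<gamma>] exI[of _ "1::real"]) simp
  then show ?thesis ..
qed

lemma unit_bundle_cross:
  assumes "(\<xi>, h) \<in> unit_bundle"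
  shows "(cos t *\<^sub>R \<xi> + sin t *\<^sub>R cross3 \<xi> h, h) \<in> unit_bundle" (is ?a)
    and "(\<xi>, cos t *\<^sub>R h + sin t *\<^sub>R cross3 \<xi> h) \<in> unit_bundle" (is ?b)
proof -
  have i: "\<xi> \<bullet> \<xi> = 1" "h \<bullet> h = 1" "\<xi> \<bullet> h = 0" "h \<bullet> \<xi> = 0"
    using assms by (auto simp: unit_bundle_def cotangent_S2_def norm_eq_1 inner_commute)
  have "cross3 \<xi> h \<bullet> cross3 \<xi> h = 1"
    using norm_cross_dot[of \<xi> h] i by (simp add: norm_eq_1[symmetric] power2_norm_eq_inner)
  note i = i this dot_cross_self
  have tr: "cos t * cos t + sin t * sin t = 1" by (simp flip: power2_eq_square)
  show ?a ?b
    unfolding unit_bundle_def cotangent_S2_def norm_eq_1 by (simp_all add: inner_simps i tr)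
qed

text \<open>
  The difference \<open>(a, b)\<close> of \<open>R\<close> and the explicit field lies in the kernel of \<open>\<lambda>\<close>, and \<open>d\<lambda>\<close> pairs it to 0
  with every tangent vector.  Turning \<open>h\<close> in
  its fibre gives a vertical test vector, which shows that \<open>a\<close> has no component along \<open>n = \<xi> \<times> h\<close>;
  hence \<open>a = 0\<close>.  Turning \<open>\<xi>\<close> about \<open>h\<close> gives a test vector which shows the same for \<open>b\<close>.  The
  remaining radial part of \<open>b\<close> vanishes because the energy has nonzero radial derivative.
\<close>

lemma reeb_vector_unique:
  assumes c: "c > 3/2" and z: "z \<in> bounded_level c"
    and R: "is_reeb_vector (bounded_level c) lambda_can z R"
  shows "R = reeb_field c z"
proof -
  have zl: "z \<in> energy_level c" and L: "orbit_radius z * ang_mom z < 1" using z by (auto simp: bounded_level_def)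
  obtain \<xi> h where u: "(\<xi>, h) \<in> unit_bundle" and zf: "z = fiber_point c (\<xi>, h)"
    using z unfolding bounded_level_eq_image[OF c] by force
  define \<rho> where "\<rho> = norm (snd z)"
  have hn: "norm h = 1" and xn: "norm \<xi> = 1" and xh: "\<xi> \<bullet> h = 0"
    using u by (auto simp: unit_bundle_def cotangent_S2_def)
  have \<rho>: "\<rho> > 0" using energy_level_covector_nonzero[OF zl] by (simp add: \<rho>_def)
  have zz: "z = (\<xi>, \<rho> *\<^sub>R h)"
    using fiber_denominator_ge_1[OF c u] hn by (simp add: zf fiber_point_def \<rho>_def)
  define n where "n = cross3 \<xi> h"
  define S where "S = R - reeb_field c z"
  define a b where "a = fst S" and "b = snd S"
  have tS: "level_tangent c z S"
    unfolding S_def reeb_field_def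
    using R tangent_space_level_tangent level_tangent_ham_field[OF zl]
    by (intro level_tangent_diff_scaleR) (auto simp: is_reeb_vector_def)
  have "lambda_can z (reeb_field c z) = 1"
    using ham_field_lambda_can[OF zl] L by (simp add: reeb_field_def lambda_can_def)
  then have aeta: "snd z \<bullet> a = 0"
    using R by (simp add: is_reeb_vector_def a_def S_def lambda_can_def inner_diff_right)
  then have ah: "h \<bullet> a = 0" using \<rho> by (simp add: zz)
  have ext: "b \<bullet> fst w - snd w \<bullet> a = 0" if w: "w \<in> tangent_space (bounded_level c) z" for w
  proof -
    have 1: "ext_deriv lambda_can z R w = 0" using R w by (simp add: is_reeb_vector_def)
    have "ext_deriv lambda_can z (ham_field c z) w = 0"
      by (rule ext_deriv_ham_field[OF tangent_space_level_tangent[OF w]])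
    then have 2: "ext_deriv lambda_can z (reeb_field c z) w = 0"
      by (simp add: ext_deriv_lambda_can reeb_field_def)
    show ?thesis using 1 2 by (simp add: ext_deriv_lambda_can a_def b_def S_def inner_simps)
  qed
  have rot: "((\<lambda>t. cos t *\<^sub>R v + sin t *\<^sub>R n) has_vector_derivative n) (at 0)" for v
    by (auto intro!: derivative_eq_intros)
  obtain k where k: "(0, \<rho> *\<^sub>R n + k *\<^sub>R h) \<in> tangent_space (bounded_level c) z"
    using tangent_space_frame_curve[OF c, of "\<lambda>t. \<xi>" "\<lambda>t. cos t *\<^sub>R h + sin t *\<^sub>R n" z 0 n]
      unit_bundle_cross(2)[OF u] rot zf by (auto simp: n_def \<rho>_def)
  have na: "n \<bullet> a = 0" using ext[OF k] \<rho> ah by (simp add: inner_simps)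
  have xa: "\<xi> \<bullet> a = 0" using tS by (simp add: level_tangent_def a_def zz)
  have a0: "a = 0"
    using orthonormal_frame_zero[OF xn hn xh] xa ah na by (simp add: n_def inner_commute)
  obtain k' where k': "(n, k' *\<^sub>R h) \<in> tangent_space (bounded_level c) z"
    using tangent_space_frame_curve[OF c, of "\<lambda>t. cos t *\<^sub>R \<xi> + sin t *\<^sub>R n" "\<lambda>t. h" z n 0]
      unit_bundle_cross(1)[OF u] rot zf by (auto simp: n_def)
  have bn: "b \<bullet> n = 0" using ext[OF k'] a0 by simp
  have xb: "\<xi> \<bullet> b = 0" using tS a0 by (simp add: level_tangent_def a_def b_def zz)
  define \<beta> where "\<beta> = b \<bullet> h"
  have bh: "b = \<beta> *\<^sub>R h"
  proof -
    have "b - \<beta> *\<^sub>R h = 0"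
    proof (rule orthonormal_frame_zero[OF xn hn xh])
      show "(b - \<beta> *\<^sub>R h) \<bullet> \<xi> = 0" using xb xh by (simp add: inner_simps inner_commute)
      show "(b - \<beta> *\<^sub>R h) \<bullet> h = 0" using hn by (simp add: inner_simps \<beta>_def norm_eq_1)
      show "(b - \<beta> *\<^sub>R h) \<bullet> cross3 \<xi> h = 0" using bn by (simp add: inner_simps n_def dot_cross_self)
    qed
    then show ?thesis by simp
  qed
  have "(snd z \<bullet> b) / \<rho>\<^sup>2 - orbit_radius z * ang_mom_deriv z (0, b) = 0"
    using tS a0 by (simp add: level_tangent_def a_def b_def ang_mom_deriv_def \<rho>_def)
  moreover have "snd z \<bullet> b = \<rho> * \<beta>" using hn by (simp add: zz bh norm_eq_1)
  moreover have "\<rho> * ang_mom_deriv z (0, b) = \<beta> * ang_mom z"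
    by (simp add: ang_mom_deriv_def ang_mom_def zz bh algebra_simps)
  ultimately have "\<beta> * (1 - orbit_radius z * ang_mom z) = 0"
    using \<rho> by (simp add: field_simps power2_eq_square)
  then have "b = 0" using L bh by simp
  then have "S = 0" using a0 by (simp add: prod_eq_iff a_def b_def)
  then show ?thesis by (simp add: S_def)
qed

lemma is_reeb_vector_reeb_field:
  assumes z: "z \<in> bounded_level c" and t: "reeb_field c z \<in> tangent_space (bounded_level c) z"
  shows "is_reeb_vector (bounded_level c) lambda_can z (reeb_field c z)"
  unfolding is_reeb_vector_def
proof (intro conjI ballI)
  show "reeb_field c z \<in> tangent_space (bounded_level c) z" by (rule t)
  have zl: "z \<in> energy_level c" and L: "orbit_radius z * ang_mom z < 1" using z by (auto simp: bounded_level_def)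
  show "lambda_can z (reeb_field c z) = 1"
    using ham_field_lambda_can[OF zl] L by (simp add: reeb_field_def lambda_can_def)
  fix w assume w: "w \<in> tangent_space (bounded_level c) z"
  have "ext_deriv lambda_can z (ham_field c z) w = 0"
    by (rule ext_deriv_ham_field[OF tangent_space_level_tangent[OF w]])
  then show "ext_deriv lambda_can z (reeb_field c z) w = 0"
    by (simp add: ext_deriv_lambda_can reeb_field_def)
qed


section \<open>A lower bound for the periods\<close>

lemma reeb_orbitD:
  assumes c: "c > 3/2" and o: "reeb_orbit (bounded_level c) lambda_can \<gamma>"
  shows "\<gamma> t \<in> bounded_level c" and "(\<gamma> has_vector_derivative reeb_field c (\<gamma> t)) (at t)"
  using o reeb_vector_unique[OF c] unfolding reeb_orbit_def by blast+

lemma reeb_field_nth: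
  "fst (reeb_field c z) $ i = fst (ham_field c z) $ i / (1 - orbit_radius z * ang_mom z)"
  "snd (reeb_field c z) $ i = snd (ham_field c z) $ i / (1 - orbit_radius z * ang_mom z)"
  by (simp_all add: reeb_field_def)

lemma ang_mom_deriv_reeb_field: "ang_mom_deriv z (reeb_field c z) = 0"
proof -
  have "ang_mom_deriv z (reeb_field c z) = ang_mom_deriv z (ham_field c z) / (1 - orbit_radius z * ang_mom z)"
    by (simp add: ang_mom_deriv_def reeb_field_nth add_divide_distrib diff_divide_distrib)
  also have "ang_mom_deriv z (ham_field c z) = 0"
    by (simp add: ang_mom_deriv_def ham_field_nth algebra_simps)
  finally show ?thesis by simp
qed

lemma ang_mom_reeb_orbit:
  assumes c: "c > 3/2" and o: "reeb_orbit (bounded_level c) lambda_can \<gamma>"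
  shows "ang_mom (\<gamma> t) = ang_mom (\<gamma> 0)"
proof -
  have "((\<lambda>t. ang_mom (\<gamma> t)) has_real_derivative 0) (at t)" for t
    using has_real_derivative_ang_mom[OF reeb_orbitD(2)[OF c o]] by (simp add: ang_mom_deriv_reeb_field)
  then show ?thesis using DERIV_isconst_all by blast
qed

text \<open>
  Let \<open>\<xi>'\<close> and \<open>\<nu>\<close> be the point of the sphere and the unit covector there after rescaling the
  momenta by \<open>1 / r\<close>.  The functions \<open>phase_Re\<close> and \<open>phase_Im\<close> are the real and imaginary parts of
  \<open>(\<xi>'\<^sub>1 + i \<xi>'\<^sub>2) - i (\<nu>\<^sub>1 + i \<nu>\<^sub>2)\<close>, expressed in \<open>(\<xi>, \<eta>)\<close>.  For the rotation by \<open>\<phi>\<close> about the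
  vertical axis combined with the rotation by \<open>\<theta>\<close> in the plane of the geodesic, this number is
  multiplied by \<open>exp (i (\<phi> + \<theta>))\<close>.  Replacing \<open>r\<close> by \<open>- r\<close> reverses the signs of \<open>\<xi>'\<^sub>1\<close> and \<open>\<xi>'\<^sub>2\<close>, and then the
  number turns by \<open>\<phi> - \<theta>\<close>.
\<close>

definition phase_Re :: "real \<Rightarrow> (real^3) \<times> (real^3) \<Rightarrow> real" where
  "phase_Re r z = r * norm (snd z) * fst z $ 1 + (r\<^sup>2 - 1) / 2 * snd z $ 3 * fst z $ 2 + snd z $ 2 / norm (snd z)"

definition phase_Im :: "real \<Rightarrow> (real^3) \<times> (real^3) \<Rightarrow> real" where
  "phase_Im r z = r * norm (snd z) * fst z $ 2 - (r\<^sup>2 - 1) / 2 * snd z $ 3 * fst z $ 1 - snd z $ 1 / norm (snd z)"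

lemma kepler_relation:
  assumes z: "z \<in> energy_level c" and r: "r\<^sup>2 = 2 * (c - ang_mom z)"
  shows "1 / norm (snd z) = 1 + (r\<^sup>2 - 1) / 2 * (1 - fst z $ 3)"
proof -
  have E: "c - ang_mom z = r\<^sup>2 / 2" using r by simp
  show ?thesis using energy_level_bracket[OF z, unfolded E] by (simp add: field_simps)
qed

text \<open>
  The modulus is 1 plus the third component of \<open>\<xi>' \<times> \<nu>\<close>, and the latter is \<open>r J\<close>.
\<close>

lemma phase_norm:
  assumes z: "z \<in> energy_level c" and r: "r\<^sup>2 = 2 * (c - ang_mom z)"
  shows "(phase_Re r z)\<^sup>2 + (phase_Im r z)\<^sup>2 = (1 + r * ang_mom z)\<^sup>2"
proof -
  have zc: "z \<in> cotangent_S2" using z by (simp add: energy_level_def)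
  note n = cotangent_S2D(1,2)[OF zc]
  define \<rho> where "\<rho> = norm (snd z)"
  define \<iota> where "\<iota> = 1 / \<rho>"
  define m where "m = (r\<^sup>2 - 1) / 2"
  have e1: "\<rho> * \<iota> = 1" using energy_level_covector_nonzero[OF z] by (simp add: \<iota>_def \<rho>_def)
  have e2: "\<iota> = 1 + m * (1 - fst z $ 3)" using kepler_relation[OF z r] by (simp add: \<iota>_def \<rho>_def m_def)
  have e3: "r\<^sup>2 = 1 + 2 * m" by (simp add: m_def field_simps)
  have e4: "\<rho>\<^sup>2 = (snd z$1)\<^sup>2 + (snd z$2)\<^sup>2 + (snd z$3)\<^sup>2" by (simp add: \<rho>_def norm3_sq)
  have e5: "(ang_mom z)\<^sup>2 = \<rho>\<^sup>2 * (1 - (fst z $ 3)\<^sup>2) - (snd z $ 3)\<^sup>2" unfolding \<rho>_def by (rule ang_mom_sq[OF zc])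
  have "(phase_Re r z)\<^sup>2 + (phase_Im r z)\<^sup>2
      = (r * \<rho> * fst z $ 1 + m * snd z $ 3 * fst z $ 2 + snd z $ 2 * \<iota>)\<^sup>2
      + (r * \<rho> * fst z $ 2 - m * snd z $ 3 * fst z $ 1 - snd z $ 1 * \<iota>)\<^sup>2"
    by (simp add: phase_Re_def phase_Im_def \<rho>_def m_def \<iota>_def)
  also have "\<dots> = (r\<^sup>2 * \<rho>\<^sup>2 + m\<^sup>2 * (snd z$3)\<^sup>2) * ((fst z$1)\<^sup>2 + (fst z$2)\<^sup>2)
      + \<iota>\<^sup>2 * ((snd z$1)\<^sup>2 + (snd z$2)\<^sup>2) + 2 * r * (\<rho> * \<iota>) * ang_mom z
      + 2 * m * \<iota> * snd z$3 * (fst z$1 * snd z$1 + fst z$2 * snd z$2)"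
    by (simp add: ang_mom_def algebra_simps power2_eq_square)
  also have "\<dots> = (r\<^sup>2 * \<rho>\<^sup>2 + m\<^sup>2 * (snd z$3)\<^sup>2) * (1 - (fst z$3)\<^sup>2)
      + \<iota>\<^sup>2 * (\<rho>\<^sup>2 - (snd z$3)\<^sup>2) + 2 * r * ang_mom z - 2 * m * \<iota> * (snd z$3)\<^sup>2 * fst z$3"
    using n e1 e4 by algebra
  also have "\<dots> = 1 + 2 * r * ang_mom z + r\<^sup>2 * (\<rho>\<^sup>2 * (1 - (fst z $ 3)\<^sup>2) - (snd z $ 3)\<^sup>2)"
    using e1 e2 e3 by algebra
  also have "\<dots> = (1 + r * ang_mom z)\<^sup>2"
    unfolding e5[symmetric] by (simp add: algebra_simps power2_eq_square)
  finally show ?thesis .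
qed

text \<open>
  The number \<open>r J\<close> is a component of a unit vector; the two squares in the proof are those of the
  third components of the other vectors of the frame, \<open>\<nu>\<close> and \<open>\<xi>'\<close>.
\<close>

lemma scaled_ang_mom_le_1:
  assumes z: "z \<in> energy_level c" and r: "r\<^sup>2 = 2 * (c - ang_mom z)"
  shows "\<bar>r * ang_mom z\<bar> \<le> 1"
proof -
  have zc: "z \<in> cotangent_S2" using z by (simp add: energy_level_def)
  define \<rho> where "\<rho> = norm (snd z)"
  define s where "s = fst z $ 3"
  have nz: "\<rho> \<noteq> 0" using energy_level_covector_nonzero[OF z] by (simp add: \<rho>_def)
  have e: "\<rho> * ((1 + s) + (1 - s) * r\<^sup>2) = 2"
    using kepler_relation[OF z r] nz unfolding \<rho>_def[symmetric] s_def[symmetric] by (simp add: field_simps)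
  have "1 - (r * ang_mom z)\<^sup>2 = (r * snd z $ 3)\<^sup>2 + (\<rho> * ((1 + s) - (1 - s) * r\<^sup>2) / 2)\<^sup>2"
  proof -
    have a: "(ang_mom z)\<^sup>2 = \<rho>\<^sup>2 * (1 - s\<^sup>2) - (snd z $ 3)\<^sup>2" unfolding \<rho>_def s_def by (rule ang_mom_sq[OF zc])
    have "4 = (\<rho> * ((1 + s) + (1 - s) * r\<^sup>2))\<^sup>2" unfolding e by simp
    then show ?thesis unfolding power_mult_distrib a by (simp add: field_simps power2_eq_square)
  qed
  also have "\<dots> \<ge> 0" by simp
  finally have "(r * ang_mom z)\<^sup>2 \<le> 1" by simp
  then show ?thesis by (simp add: abs_square_le_1)
qed

text \<open>
  The vector \<open>(f, g)\<close> turns by the angle \<open>\<theta>\<close>, so that it returns to its nonzero initial value only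
  if \<open>\<theta>\<close> has grown by a multiple of \<open>2 \<pi>\<close>.
\<close>

lemma rotation_period:
  fixes f g \<theta> \<kappa> :: "real \<Rightarrow> real"
  assumes f: "\<And>t. (f has_real_derivative - \<kappa> t * g t) (at t)"
    and g: "\<And>t. (g has_real_derivative \<kappa> t * f t) (at t)"
    and \<theta>: "\<And>t. (\<theta> has_real_derivative \<kappa> t) (at t)"
    and per: "f T = f 0" "g T = g 0" and ne: "(f 0)\<^sup>2 + (g 0)\<^sup>2 \<noteq> 0"
    and dT: "\<theta> T - \<theta> 0 = \<omega> * T" and T: "T > 0" and \<omega>: "\<omega> \<noteq> 0"
  shows "T \<ge> 2 * pi / \<bar>\<omega>\<bar>"
proof -
  have "((\<lambda>t. cos (\<theta> t) * f t + sin (\<theta> t) * g t) has_real_derivative 0) (at t)" for t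
    by (rule derivative_eq_intros f g \<theta> refl)+ (simp add: algebra_simps)
  then have 1: "cos (\<theta> T) * f T + sin (\<theta> T) * g T = cos (\<theta> 0) * f 0 + sin (\<theta> 0) * g 0"
    using DERIV_isconst_all by blast
  have "((\<lambda>t. cos (\<theta> t) * g t - sin (\<theta> t) * f t) has_real_derivative 0) (at t)" for t
    by (rule derivative_eq_intros f g \<theta> refl)+ (simp add: algebra_simps)
  then have 2: "cos (\<theta> T) * g T - sin (\<theta> T) * f T = cos (\<theta> 0) * g 0 - sin (\<theta> 0) * f 0"
    using DERIV_isconst_all by blast
  have "((f 0)\<^sup>2 + (g 0)\<^sup>2) * (cos (\<theta> T) - cos (\<theta> 0)) = 0" "((f 0)\<^sup>2 + (g 0)\<^sup>2) * (sin (\<theta> T) - sin (\<theta> 0)) = 0"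
    using 1 2 unfolding per by algebra+
  then have "cos (\<theta> T) = cos (\<theta> 0)" "sin (\<theta> T) = sin (\<theta> 0)" by (metis mult_eq_0_iff right_minus_eq ne)+
  then have "cos (\<theta> T - \<theta> 0) = 1"
    by (simp add: cos_diff)
  then have "cos (\<bar>\<omega>\<bar> * T) = 1" using T unfolding dT by (metis abs_mult abs_of_pos cos_abs_real)
  then obtain n :: int where n: "\<bar>\<omega>\<bar> * T = of_int n * 2 * pi" using cos_one_2pi_int by blast
  have p: "\<bar>\<omega>\<bar> * T > 0" using T \<omega> by simp
  then have "n > 0" using n by (simp add: zero_less_mult_iff)
  then have "1 * (2 * pi) \<le> of_int n * (2 * pi)" by (intro mult_right_mono) auto
  then have "2 * pi \<le> \<bar>\<omega>\<bar> * T" using n by simp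
  then show ?thesis using \<omega> by (simp add: field_simps)
qed

text \<open>
  The phase turns at the nonconstant rate \<open>\<kappa>\<close>, but \<open>\<kappa>\<close> differs from the constant \<open>\<omega>\<close> by a multiple of
  the derivative of \<open>\<eta>\<^sub>3\<close>: this is Kepler's equation.  As \<open>\<eta>\<^sub>3\<close> is periodic along the orbit, the
  phase advances by \<open>\<omega> T\<close> in one period.
\<close>

lemma reeb_orbit_phase_period:
  assumes c: "c > 3/2" and o: "reeb_orbit (bounded_level c) lambda_can \<gamma>"
    and T: "T > 0" and per: "\<And>t. \<gamma> (t + T) = \<gamma> t"
    and r: "r\<^sup>2 = 2 * (c - ang_mom (\<gamma> 0))" and ne: "1 + r * ang_mom (\<gamma> 0) \<noteq> 0"
    and den: "r\<^sup>2 - ang_mom (\<gamma> 0) \<noteq> 0" and r1: "r ^ 3 \<noteq> 1"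
  shows "T \<ge> 2 * pi / \<bar>(r ^ 3 - 1) / (r\<^sup>2 - ang_mom (\<gamma> 0))\<bar>"
proof -
  define J where "J = ang_mom (\<gamma> 0)"
  define \<omega> where "\<omega> = (r ^ 3 - 1) / (r\<^sup>2 - J)"
  \<comment> \<open>With \<open>k = r - \<omega>\<close>, comparing coefficients of \<open>|q|\<close> in \<open>\<theta>' = \<kappa>\<close> leaves \<open>\<omega> (r\<^sup>2 - J) = r\<^sup>3 - 1\<close>.\<close>
  define k where "k = r - \<omega>"
  define m where "m = (r\<^sup>2 - 1) / 2"
  define \<kappa> where "\<kappa> = (\<lambda>t. (r - orbit_radius (\<gamma> t)) / (1 - orbit_radius (\<gamma> t) * J))"
  define \<theta> where "\<theta> = (\<lambda>t. \<omega> * t - k * snd (\<gamma> t) $ 3)"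
  note orb = reeb_orbitD[OF c o]
  have J: "ang_mom (\<gamma> t) = J" for t using ang_mom_reeb_orbit[OF c o] by (simp add: J_def)
  have zl: "\<gamma> t \<in> energy_level c" and L: "1 - orbit_radius (\<gamma> t) * J \<noteq> 0" for t
    using orb(1)[of t] J[of t] by (auto simp: bounded_level_def)
  have m: "c - J - 1/2 = m" using r by (simp add: m_def J_def)
  note dz = has_real_derivative_components[OF orb(2)]
  have nz: "norm (snd (\<gamma> t)) \<noteq> 0" for t using energy_level_covector_nonzero[OF zl] by simp
  have dn: "((\<lambda>t. norm (snd (\<gamma> t))) has_real_derivative m * snd (\<gamma> t) $ 3 / (1 - orbit_radius (\<gamma> t) * J)) (at t)" for t
  proof -
    have "\<gamma> t \<in> cotangent_S2" using zl[of t] by (simp add: energy_level_def)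
    from inner_snd_ham_field[OF this, of c]
    have "snd (\<gamma> t) \<bullet> snd (ham_field c (\<gamma> t)) = norm (snd (\<gamma> t)) * m * snd (\<gamma> t) $ 3"
      unfolding J m .
    then have eq: "snd (\<gamma> t) \<bullet> snd (reeb_field c (\<gamma> t)) / norm (snd (\<gamma> t))
        = m * snd (\<gamma> t) $ 3 / (1 - orbit_radius (\<gamma> t) * J)"
      using nz by (simp add: reeb_field_def J)
    have "snd (\<gamma> t) \<noteq> 0" using nz[of t] by simp
    from has_real_derivative_norm_snd[OF orb(2) this] show ?thesis by (simp only: eq)
  qed
  have rel: "norm (snd (\<gamma> t)) * (1 + m * (1 - fst (\<gamma> t) $ 3)) = 1" for t
  proof -
    have "1 / norm (snd (\<gamma> t)) = 1 + m * (1 - fst (\<gamma> t) $ 3)"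
      unfolding m_def using r J[of t] by (intro kepler_relation[OF zl]) (simp add: J_def)
    then show ?thesis using nz[of t] by (metis nonzero_mult_div_cancel_left times_divide_eq_right mult.right_neutral)
  qed
  have rm: "r\<^sup>2 = 1 + 2 * m" by (simp add: m_def field_simps)
  have d3: "snd (ham_field c (\<gamma> t)) $ 3 = r\<^sup>2 * orbit_radius (\<gamma> t) - 1" for t
    using rel[of t] rm unfolding ham_field_nth J m orbit_radius_def by algebra
  have \<theta>': "(\<theta> has_real_derivative \<kappa> t) (at t)" for t
  proof -
    have "\<omega> - k * ((r\<^sup>2 * orbit_radius (\<gamma> t) - 1) / (1 - orbit_radius (\<gamma> t) * J)) = \<kappa> t"
    proof -
      have "\<omega> * (r\<^sup>2 - J) = r ^ 3 - 1" using den by (simp add: \<omega>_def J_def)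
      then have "\<omega> * (1 - orbit_radius (\<gamma> t) * J) - k * (r\<^sup>2 * orbit_radius (\<gamma> t) - 1) = r - orbit_radius (\<gamma> t)"
        unfolding k_def by algebra
      then show ?thesis using L[of t] by (simp add: \<kappa>_def field_simps)
    qed
    then show ?thesis
      unfolding \<theta>_def
      by - ((rule derivative_eq_intros dz refl)+, simp add: reeb_field_nth d3 J mult_ac)
  qed
  have f': "((\<lambda>t. phase_Re r (\<gamma> t)) has_real_derivative - \<kappa> t * phase_Im r (\<gamma> t)) (at t)"
    and g': "((\<lambda>t. phase_Im r (\<gamma> t)) has_real_derivative \<kappa> t * phase_Re r (\<gamma> t)) (at t)" for t
  proof -
    define \<rho> where "\<rho> = norm (snd (\<gamma> t))"
    define \<iota> where "\<iota> = 1 / \<rho>"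
    define q where "q = orbit_radius (\<gamma> t)"
    define \<Lambda> where "\<Lambda> = 1 - q * J"
    define x1 x2 x3 y1 y2 y3 where "x1 = fst (\<gamma> t) $ 1" and "x2 = fst (\<gamma> t) $ 2" and "x3 = fst (\<gamma> t) $ 3"
      and "y1 = snd (\<gamma> t) $ 1" and "y2 = snd (\<gamma> t) $ 2" and "y3 = snd (\<gamma> t) $ 3"
    note defs = x1_def x2_def x3_def y1_def y2_def y3_def
    have e1: "\<rho> * \<iota> = 1" using nz by (simp add: \<iota>_def \<rho>_def)
    have e2: "\<iota> = 1 + m * (1 - x3)" using rel[of t] nz[of t] by (simp add: \<iota>_def \<rho>_def x3_def field_simps)
    have i2: "a / \<rho>\<^sup>2 = a * \<iota>\<^sup>2" for a by (simp add: \<iota>_def power_divide)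
    define \<mu> where "\<mu> = 1 + \<rho> * m * x3"
    define h3 where "h3 = \<rho> * m - \<mu> * x3"
    have h: "fst (ham_field c (\<gamma> t)) $ 1 = y1 * \<iota>\<^sup>2 + q * x2" "fst (ham_field c (\<gamma> t)) $ 2 = y2 * \<iota>\<^sup>2 - q * x1"
      "snd (ham_field c (\<gamma> t)) $ 1 = q * y2 - \<mu> * x1"
      "snd (ham_field c (\<gamma> t)) $ 2 = - q * y1 - \<mu> * x2"
      "snd (ham_field c (\<gamma> t)) $ 3 = h3"
      unfolding ham_field_nth J m h3_def \<mu>_def by (simp_all add: i2 flip: defs \<rho>_def q_def)
    \<comment> \<open>This is the coefficient of \<open>x2\<close>, respectively \<open>- x1\<close>, left over in the derivative of the phase.\<close>
    have e3: "m * h3 - \<mu> * \<iota> + r\<^sup>2 * \<rho> = 0"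
      unfolding h3_def \<mu>_def using e1 e2 rm by algebra
    have e4: "\<rho> * \<iota>\<^sup>2 = \<iota>" using e1 by algebra
    have quot: "((\<lambda>t. snd (\<gamma> t) $ i / norm (snd (\<gamma> t))) has_real_derivative
        snd (ham_field c (\<gamma> t)) $ i / \<Lambda> * \<iota> - snd (\<gamma> t) $ i * (m * y3 / \<Lambda>) * \<iota>\<^sup>2) (at t)" for i
    proof (rule DERIV_cong[OF DERIV_divide[OF dz(2) dn nz]])
      have *: "(b * \<rho> - y * d) / (\<rho> * \<rho>) = b * \<iota> - y * d * \<iota>\<^sup>2" for b y d
        using e1 by (simp add: \<iota>_def diff_divide_distrib power2_eq_square)
      show "(snd (reeb_field c (\<gamma> t)) $ i * norm (snd (\<gamma> t))
            - snd (\<gamma> t) $ i * (m * snd (\<gamma> t) $ 3 / (1 - orbit_radius (\<gamma> t) * J)))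
          / (norm (snd (\<gamma> t)) * norm (snd (\<gamma> t)))
          = snd (ham_field c (\<gamma> t)) $ i / \<Lambda> * \<iota> - snd (\<gamma> t) $ i * (m * y3 / \<Lambda>) * \<iota>\<^sup>2"
        unfolding reeb_field_nth J \<rho>_def[symmetric] q_def[symmetric] \<Lambda>_def[symmetric] y3_def[symmetric]
        by (rule *)
    qed
    have dRe: "((\<lambda>t. phase_Re r (\<gamma> t)) has_real_derivative
       (r * (m * y3 * x1 + \<rho> * fst (ham_field c (\<gamma> t)) $ 1)
       + m * (snd (ham_field c (\<gamma> t)) $ 3 * x2 + y3 * fst (ham_field c (\<gamma> t)) $ 2)
       + (snd (ham_field c (\<gamma> t)) $ 2 * \<iota> - y2 * (m * y3) * \<iota>\<^sup>2)) / \<Lambda>) (at t)"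
      unfolding phase_Re_def m_def[symmetric]
      by (rule quot dn dz | rule derivative_eq_intros refl)+
        (simp add: reeb_field_nth J flip: defs \<rho>_def q_def \<Lambda>_def,
         simp add: algebra_simps add_divide_distrib diff_divide_distrib)
    have aRe: "r * (m * y3 * x1 + \<rho> * fst (ham_field c (\<gamma> t)) $ 1)
       + m * (snd (ham_field c (\<gamma> t)) $ 3 * x2 + y3 * fst (ham_field c (\<gamma> t)) $ 2)
       + (snd (ham_field c (\<gamma> t)) $ 2 * \<iota> - y2 * (m * y3) * \<iota>\<^sup>2)
       = - (r - q) * (r * \<rho> * x2 - m * y3 * x1 - y1 * \<iota>)"
      unfolding h using e3 e4 by algebra
    have dIm: "((\<lambda>t. phase_Im r (\<gamma> t)) has_real_derivative
       (r * (m * y3 * x2 + \<rho> * fst (ham_field c (\<gamma> t)) $ 2)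
       - m * (snd (ham_field c (\<gamma> t)) $ 3 * x1 + y3 * fst (ham_field c (\<gamma> t)) $ 1)
       - (snd (ham_field c (\<gamma> t)) $ 1 * \<iota> - y1 * (m * y3) * \<iota>\<^sup>2)) / \<Lambda>) (at t)"
      unfolding phase_Im_def m_def[symmetric]
      by (rule quot dn dz | rule derivative_eq_intros refl)+
        (simp add: reeb_field_nth J flip: defs \<rho>_def q_def \<Lambda>_def,
         simp add: algebra_simps add_divide_distrib diff_divide_distrib)
    have aIm: "r * (m * y3 * x2 + \<rho> * fst (ham_field c (\<gamma> t)) $ 2)
       - m * (snd (ham_field c (\<gamma> t)) $ 3 * x1 + y3 * fst (ham_field c (\<gamma> t)) $ 1)
       - (snd (ham_field c (\<gamma> t)) $ 1 * \<iota> - y1 * (m * y3) * \<iota>\<^sup>2)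
       = (r - q) * (r * \<rho> * x1 + m * y3 * x2 + y2 * \<iota>)"
      unfolding h using e3 e4 by algebra
    have Re: "(r * \<rho> * x1 + m * y3 * x2 + y2 * \<iota>) = phase_Re r (\<gamma> t)"
      and Im: "(r * \<rho> * x2 - m * y3 * x1 - y1 * \<iota>) = phase_Im r (\<gamma> t)"
      by (simp_all add: phase_Re_def phase_Im_def \<rho>_def defs \<iota>_def flip: m_def)
    have \<kappa>: "\<kappa> t = (r - q) / \<Lambda>" by (simp add: \<kappa>_def q_def \<Lambda>_def)
    show "((\<lambda>t. phase_Re r (\<gamma> t)) has_real_derivative - \<kappa> t * phase_Im r (\<gamma> t)) (at t)"
      using dRe unfolding aRe Im \<kappa> by (simp only: minus_divide_left times_divide_eq_left)
    show "((\<lambda>t. phase_Im r (\<gamma> t)) has_real_derivative \<kappa> t * phase_Re r (\<gamma> t)) (at t)"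
      using dIm unfolding aIm Re \<kappa> by (simp only: times_divide_eq_left)
  qed
  have g0: "\<gamma> T = \<gamma> 0" using per[of 0] by simp
  have "(phase_Re r (\<gamma> 0))\<^sup>2 + (phase_Im r (\<gamma> 0))\<^sup>2 \<noteq> 0"
    using phase_norm[OF zl r] ne by simp
  then have "T \<ge> 2 * pi / \<bar>\<omega>\<bar>"
    using rotation_period[OF f' g' \<theta>', of T \<omega>] T g0 den r1
    by (simp add: \<theta>_def \<omega>_def J_def)
  then show ?thesis by (simp add: \<omega>_def J_def)
qed

text \<open>
  Over the north pole \<open>J = 0\<close>.  If the bound failed somewhere, then \<open>J = c - 1/2\<close> would hold at
  some point of the connected set.  There the energy equation reduces to \<open>|\<eta>| = 1\<close>, whence
  \<open>J \<le> 1 < c - 1/2\<close>.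
\<close>

lemma kepler_energy_bound:
  assumes c: "c > 3/2" and z: "z \<in> bounded_level c"
  shows "2 * (c - ang_mom z) > 1"
proof (rule ccontr)
  assume "\<not> 2 * (c - ang_mom z) > 1"
  then have le: "c - 1/2 \<le> ang_mom z" by simp
  have "(axis 3 1, axis 1 1) \<in> unit_bundle"
    by (simp add: unit_bundle_def cotangent_S2_def inner_axis_axis)
  then have z0: "fiber_point c (axis 3 1, axis 1 1) \<in> bounded_level c" unfolding bounded_level_eq_image[OF c] by blast
  have "ang_mom (fiber_point c (axis 3 1, axis 1 1)) = 0" by (simp add: fiber_point_def ang_mom_def axis_def)
  then have i0: "0 \<in> ang_mom ` bounded_level c" using z0 by (metis image_eqI)
  have "connected (ang_mom ` bounded_level c)"
    by (intro connected_continuous_image continuous_on_ang_mom connected_bounded_level[OF c])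
  then have "{0..ang_mom z} \<subseteq> ang_mom ` bounded_level c"
    using i0 z by (intro connected_contains_Icc) auto
  moreover have "c - 1/2 \<in> {0..ang_mom z}" using le c by simp
  ultimately have "c - 1/2 \<in> ang_mom ` bounded_level c" by blast
  then obtain w where w: "w \<in> bounded_level c" "ang_mom w = c - 1/2" by auto
  have wl: "w \<in> energy_level c" and wc: "w \<in> cotangent_S2" using w by (auto simp: bounded_level_def energy_level_def)
  have "norm (snd w) = 1" using wl w(2) by (simp add: energy_level_def moser_ham_def field_simps)
  then have "(ang_mom w)\<^sup>2 \<le> 1" unfolding ang_mom_sq[OF wc] by simp
  then have "ang_mom w \<le> 1" by (auto simp: abs_square_le_1)
  then show False using w(2) c by simp
qed

text \<open>
  Here \<open>- r\<^sup>2 / 2\<close> is the Kepler energy of the orbit.  If \<open>r J \<noteq> - 1\<close>, the sum of the two angles gives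
  the bound; otherwise the orbit is circular, the sum is undefined, and the difference is used.
\<close>

lemma reeb_period_bound:
  assumes c: "c > 3/2" and o: "reeb_orbit (bounded_level c) lambda_can \<gamma>"
    and T: "T > 0" and per: "\<And>t. \<gamma> (t + T) = \<gamma> t"
  shows "\<exists>r>0. r\<^sup>2 / 2 - 1 / r \<le> c \<and> 2 * pi / r \<le> T"
proof -
  define J where "J = ang_mom (\<gamma> 0)"
  define r where "r = sqrt (2 * (c - J))"
  have z: "\<gamma> 0 \<in> bounded_level c" by (rule reeb_orbitD(1)[OF c o])
  have zl: "\<gamma> 0 \<in> energy_level c" using z by (simp add: bounded_level_def)
  have r2: "r\<^sup>2 = 2 * (c - J)" and r1: "r > 1"
    using kepler_energy_bound[OF c z] by (auto simp: r_def J_def)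
  have "\<bar>r * J\<bar> \<le> 1" using scaled_ang_mom_le_1[OF zl] r2 by (simp add: J_def)
  then have rJ: "- 1 \<le> r * J" "r * J \<le> 1" by auto
  have r3: "r ^ 3 > 1" using r1 by (simp add: one_less_power)
  have den: "r\<^sup>2 - J > 0"
  proof -
    have "r * (r\<^sup>2 - J) = r ^ 3 - r * J" by (simp add: algebra_simps power2_eq_square power3_eq_cube)
    also have "\<dots> > 0" using r3 rJ by simp
    finally show ?thesis using r1 by (simp add: zero_less_mult_iff)
  qed
  have "- (1 / r) \<le> J" using rJ r1 by (simp add: field_simps)
  moreover have "r\<^sup>2 / 2 = c - J" using r2 by simp
  ultimately have "r\<^sup>2 / 2 - 1 / r \<le> c" by linarith
  moreover have "2 * pi / r \<le> T"
  proof (cases "r * J = - 1")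
    case True
    have "T \<ge> 2 * pi / \<bar>((- r) ^ 3 - 1) / ((- r)\<^sup>2 - J)\<bar>"
      unfolding J_def
    proof (rule reeb_orbit_phase_period[OF c o T per])
      show "(- r)\<^sup>2 = 2 * (c - ang_mom (\<gamma> 0))" using r2 by (simp add: J_def)
      show "1 + (- r) * ang_mom (\<gamma> 0) \<noteq> 0" using True by (simp add: J_def)
      show "(- r)\<^sup>2 - ang_mom (\<gamma> 0) \<noteq> 0" using den by (simp add: J_def)
      show "(- r) ^ 3 \<noteq> 1" using r3 by simp
    qed
    moreover have "((- r) ^ 3 - 1) / ((- r)\<^sup>2 - J) = - r"
      using den True by (simp add: field_simps power2_eq_square power3_eq_cube)
    ultimately have "2 * pi / \<bar>- r\<bar> \<le> T" by (simp only:)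
    then show ?thesis using r1 by simp
  next
    case False
    define \<omega> where "\<omega> = (r ^ 3 - 1) / (r\<^sup>2 - J)"
    have "T \<ge> 2 * pi / \<bar>\<omega>\<bar>"
      unfolding J_def \<omega>_def
    proof (rule reeb_orbit_phase_period[OF c o T per])
      show "r\<^sup>2 = 2 * (c - ang_mom (\<gamma> 0))" using r2 by (simp add: J_def)
      show "1 + r * ang_mom (\<gamma> 0) \<noteq> 0" using False by (simp add: J_def)
      show "r\<^sup>2 - ang_mom (\<gamma> 0) \<noteq> 0" using den by (simp add: J_def)
      show "r ^ 3 \<noteq> 1" using r3 by simp
    qed
    moreover have "\<omega> > 0" using r3 den by (simp add: \<omega>_def)
    moreover have "\<omega> \<le> r"
      using rJ den by (simp add: \<omega>_def pos_divide_le_eq algebra_simps power2_eq_square power3_eq_cube)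
    ultimately have "2 * pi / r \<le> 2 * pi / \<omega>" "T \<ge> 2 * pi / \<omega>"
      by (auto intro!: divide_left_mono)
    then show ?thesis by linarith
  qed
  ultimately show ?thesis using r1 by (intro exI[of _ r]) simp
qed


section \<open>The shortest orbit\<close>

text \<open>
  The circular Kepler orbit of energy \<open>- r\<^sup>2 / 2\<close> and angular momentum \<open>- 1 / r\<close>: momentum of length
  \<open>r\<close> and radius \<open>1 / r\<^sup>2\<close>, which the Reeb flow turns about the vertical axis at the rate \<open>- r\<close>.
\<close>

definition circular_orbit :: "real \<Rightarrow> real \<Rightarrow> (real^3) \<times> (real^3)" where
  "circular_orbit r t =
    ((2 * r / (r\<^sup>2 + 1) * cos (r * t)) *\<^sub>R axis 1 1 - (2 * r / (r\<^sup>2 + 1) * sin (r * t)) *\<^sub>R axis 2 1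
       + ((r\<^sup>2 - 1) / (r\<^sup>2 + 1)) *\<^sub>R axis 3 1,
     - ((r\<^sup>2 + 1) / (2 * r\<^sup>2) * sin (r * t)) *\<^sub>R axis 1 1 - ((r\<^sup>2 + 1) / (2 * r\<^sup>2) * cos (r * t)) *\<^sub>R axis 2 1)"

lemma circular_orbit_periodic:
  assumes "r > 0"
  shows "circular_orbit r (t + 2 * pi / r) = circular_orbit r t"
proof -
  have "r * (t + 2 * pi / r) = r * t + 2 * pi" using assms by (simp add: field_simps)
  then show ?thesis by (simp add: circular_orbit_def)
qed

lemma circular_reeb_orbit:
  assumes r: "r > 0" and cr: "c = r\<^sup>2 / 2 - 1 / r"
  shows "reeb_orbit (bounded_level c) lambda_can (circular_orbit r)"
proof -
  define \<gamma> where "\<gamma> = circular_orbit r"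
  define N where "N = r\<^sup>2 + 1"
  define A where "A = 2 * r / N"
  define \<rho> where "\<rho> = N / (2 * r\<^sup>2)"
  have N: "N > 0" by (simp add: N_def add_nonneg_pos)
  have \<rho>: "\<rho> > 0" using N r by (simp add: \<rho>_def)
  have g: "fst (\<gamma> t) $ 1 = A * cos (r * t)" "fst (\<gamma> t) $ 2 = - (A * sin (r * t))" "fst (\<gamma> t) $ 3 = (r\<^sup>2 - 1) / N"
    "snd (\<gamma> t) $ 1 = - (\<rho> * sin (r * t))" "snd (\<gamma> t) $ 2 = - (\<rho> * cos (r * t))" "snd (\<gamma> t) $ 3 = 0" for t
    by (simp_all add: \<gamma>_def circular_orbit_def axis_def A_def \<rho>_def N_def)
  have nrm: "norm (snd (\<gamma> t)) = \<rho>" for t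
  proof -
    have "(norm (snd (\<gamma> t)))\<^sup>2 = \<rho>\<^sup>2 * ((sin (r * t))\<^sup>2 + (cos (r * t))\<^sup>2)"
      unfolding norm3_sq g
      by (simp only: power2_minus power_mult_distrib distrib_left zero_power2 add_0_right add_ac)
    then have "(norm (snd (\<gamma> t)))\<^sup>2 = \<rho>\<^sup>2" by (simp only: sin_cos_squared_add mult_1_right)
    then show ?thesis using \<rho> by simp
  qed
  have \<rho>N: "\<rho> * (2 * r\<^sup>2) = N" using N r by (simp add: \<rho>_def)
  have A\<rho>: "A * \<rho> = 1 / r"
    using N r by (simp add: A_def \<rho>_def power2_eq_square)
  have J: "ang_mom (\<gamma> t) = - (1 / r)" for t
  proof -
    have "ang_mom (\<gamma> t) = - (A * \<rho>) * ((sin (r * t))\<^sup>2 + (cos (r * t))\<^sup>2)"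
      unfolding ang_mom_def g by algebra
    then show ?thesis by (simp only: sin_cos_squared_add A\<rho> mult_1_right)
  qed
  have h: "1 - fst (\<gamma> t) $ 3 = 2 / N" "1 + fst (\<gamma> t) $ 3 = 2 * r\<^sup>2 / N" for t
    unfolding g using N by (simp_all add: field_simps N_def)
  have q: "orbit_radius (\<gamma> t) = 1 / r\<^sup>2" for t
    unfolding orbit_radius_def nrm h using N by (simp add: \<rho>_def)
  have "(norm (fst (\<gamma> t)))\<^sup>2 = 1" for t
  proof -
    have "(norm (fst (\<gamma> t)))\<^sup>2 = A\<^sup>2 * ((sin (r * t))\<^sup>2 + (cos (r * t))\<^sup>2) + ((r\<^sup>2 - 1) / N)\<^sup>2"
      unfolding norm3_sq g
      by (simp only: power2_minus power_mult_distrib distrib_left zero_power2 add_0_right add_ac)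
    also have "\<dots> = (4 * r\<^sup>2 + (r\<^sup>2 - 1)\<^sup>2) / N\<^sup>2"
      unfolding sin_cos_squared_add by (simp add: A_def power_divide power_mult_distrib add_divide_distrib)
    also have "4 * r\<^sup>2 + (r\<^sup>2 - 1)\<^sup>2 = N\<^sup>2" by (simp add: N_def power2_eq_square algebra_simps)
    finally show ?thesis using N by simp
  qed
  then have "norm (fst (\<gamma> t)) = 1" for t by (metis norm_ge_zero power2_eq_iff_nonneg one_power2 zero_le_one)
  moreover have "fst (\<gamma> t) \<bullet> snd (\<gamma> t) = 0" for t
    unfolding inner3 g by simp
  ultimately have zc: "\<gamma> t \<in> cotangent_S2" for t by (simp add: cotangent_S2_def case_prod_beta)
  have cJ: "c - ang_mom (\<gamma> t) = r\<^sup>2 / 2" for t by (simp add: J cr)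
  have "moser_ham c (\<gamma> t) = 1" for t
    unfolding moser_ham_def nrm h cJ using \<rho>N N by (simp add: field_simps)
  then have zl: "\<gamma> t \<in> energy_level c" for t using zc by (simp add: energy_level_def)
  have "1 / r\<^sup>2 * (1 / r) > 0" using r by simp
  then have "orbit_radius (\<gamma> t) * ang_mom (\<gamma> t) < 1" for t
    unfolding q J mult_minus_right by linarith
  then have zb: "\<gamma> t \<in> bounded_level c" for t using zl by (simp add: bounded_level_def)
  have \<gamma>_eq: "\<gamma> = (\<lambda>t. ((A * cos (r * t)) *\<^sub>R axis 1 1 - (A * sin (r * t)) *\<^sub>R axis 2 1
       + ((r\<^sup>2 - 1) / N) *\<^sub>R axis 3 1, - (\<rho> * sin (r * t)) *\<^sub>R axis 1 1 - (\<rho> * cos (r * t)) *\<^sub>R axis 2 1))"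
    by (simp add: \<gamma>_def fun_eq_iff circular_orbit_def A_def \<rho>_def N_def)
  have d: "(\<gamma> has_vector_derivative
      (- (r * A * sin (r * t)) *\<^sub>R axis 1 1 - (r * A * cos (r * t)) *\<^sub>R axis 2 1,
       - (r * \<rho> * cos (r * t)) *\<^sub>R axis 1 1 + (r * \<rho> * sin (r * t)) *\<^sub>R axis 2 1)) (at t)" for t
    unfolding \<gamma>_eq
    by (rule has_vector_derivative_Pair; auto intro!: derivative_eq_intros simp: algebra_simps)
  have L: "1 - orbit_radius (\<gamma> t) * ang_mom (\<gamma> t) = (r ^ 3 + 1) / r ^ 3" for t
    unfolding q J using r by (simp add: field_simps power2_eq_square power3_eq_cube)
  have r3: "r ^ 3 + 1 > 0" using r by (simp add: add_pos_pos)
  have mu: "1 + \<rho> * ((r\<^sup>2 - 1) / 2) * ((r\<^sup>2 - 1) / N) = N\<^sup>2 / (4 * r\<^sup>2)"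
  proof -
    have "\<rho> * (x / 2) * (x / N) = x\<^sup>2 / (4 * r\<^sup>2)" for x
      using N by (simp add: \<rho>_def power2_eq_square)
    moreover have "1 + (r\<^sup>2 - 1)\<^sup>2 / (4 * r\<^sup>2) = (4 * r\<^sup>2 + (r\<^sup>2 - 1)\<^sup>2) / (4 * r\<^sup>2)"
      using r by (simp add: add_divide_distrib)
    moreover have "4 * r\<^sup>2 + (r\<^sup>2 - 1)\<^sup>2 = N\<^sup>2" by (simp add: N_def power2_eq_square algebra_simps)
    ultimately show ?thesis by simp
  qed
  have "reeb_field c (\<gamma> t) =
      (- (r * A * sin (r * t)) *\<^sub>R axis 1 1 - (r * A * cos (r * t)) *\<^sub>R axis 2 1,
       - (r * \<rho> * cos (r * t)) *\<^sub>R axis 1 1 + (r * \<rho> * sin (r * t)) *\<^sub>R axis 2 1)" (is "_ = ?R") for t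
  proof -
    have m: "c - ang_mom (\<gamma> t) - 1/2 = (r\<^sup>2 - 1) / 2" by (simp add: cJ diff_divide_distrib)
    have e1: "1 / \<rho> + A / r\<^sup>2 = r * A * ((r ^ 3 + 1) / r ^ 3)"
      using N r unfolding \<rho>_def A_def by (simp add: field_simps power2_eq_square power3_eq_cube)
    have e2: "\<rho> / r\<^sup>2 + N\<^sup>2 / (4 * r\<^sup>2) * A = r * \<rho> * ((r ^ 3 + 1) / r ^ 3)"
      using N r unfolding \<rho>_def A_def by (simp add: field_simps power2_eq_square power3_eq_cube)
    have e3: "\<rho> * ((r\<^sup>2 - 1) / 2) - N\<^sup>2 / (4 * r\<^sup>2) * ((r\<^sup>2 - 1) / N) = 0"
      using N r unfolding \<rho>_def by (simp add: field_simps power2_eq_square)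
    have "ham_field c (\<gamma> t) = ((r ^ 3 + 1) / r ^ 3) *\<^sub>R ?R"
    proof -
      have "fst (ham_field c (\<gamma> t)) $ 1 = - (1 / \<rho> + A / r\<^sup>2) * sin (r * t)"
        unfolding ham_field_nth q nrm g using \<rho> by (simp add: algebra_simps power2_eq_square)
      moreover have "fst (ham_field c (\<gamma> t)) $ 2 = - (1 / \<rho> + A / r\<^sup>2) * cos (r * t)"
        unfolding ham_field_nth q nrm g using \<rho> by (simp add: algebra_simps power2_eq_square)
      moreover have "fst (ham_field c (\<gamma> t)) $ 3 = 0"
        unfolding ham_field_nth g by simp
      moreover have "snd (ham_field c (\<gamma> t)) $ 1 = - (\<rho> / r\<^sup>2 + N\<^sup>2 / (4 * r\<^sup>2) * A) * cos (r * t)"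
        unfolding ham_field_nth q nrm m g mu by (simp add: algebra_simps)
      moreover have "snd (ham_field c (\<gamma> t)) $ 2 = (\<rho> / r\<^sup>2 + N\<^sup>2 / (4 * r\<^sup>2) * A) * sin (r * t)"
        unfolding ham_field_nth q nrm m g mu by (simp add: algebra_simps)
      moreover have "snd (ham_field c (\<gamma> t)) $ 3 = 0"
        unfolding ham_field_nth q nrm m g mu by (rule e3)
      ultimately show ?thesis
        unfolding e1 e2 by (simp add: prod_eq_iff vec3_eq axis_def)
    qed
    then show ?thesis using r r3 by (simp add: reeb_field_def L)
  qed
  then have d': "(\<gamma> has_vector_derivative reeb_field c (\<gamma> t)) (at t)" for t using d[of t] by simp
  have "reeb_field c (\<gamma> t) \<in> tangent_space (bounded_level c) (\<gamma> t)" for t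
  proof -
    have "((\<lambda>s. \<gamma> (t + s)) has_vector_derivative reeb_field c (\<gamma> t)) (at 0)"
    proof -
      have "((\<lambda>s. t + s) has_vector_derivative 0 + 1) (at 0)"
        by (intro has_vector_derivative_add has_vector_derivative_const has_vector_derivative_id)
      from vector_diff_chain_at[OF this, of \<gamma> "reeb_field c (\<gamma> t)"] show ?thesis
        using d'[of t] by (simp add: o_def)
    qed
    then show ?thesis
      unfolding tangent_space_def mem_Collect_eq using zb
      by (intro exI[of _ "\<lambda>s. \<gamma> (t + s)"] exI[of _ "1::real"]) simp
  qed
  then show ?thesis
    unfolding reeb_orbit_def \<gamma>_def[symmetric] using zb d' is_reeb_vector_reeb_field by blast
qed

text \<open>
  The equation is equivalent to \<open>2 x\<^sup>3 + 2 c x\<^sup>2 = 1\<close>, which has a root in \<open>(0, 1)\<close>; it is unique because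
  \<open>1 / (2 x\<^sup>2) - x\<close> decreases strictly.
\<close>

lemma L_R_root:
  assumes c: "c > 3/2"
  shows "L_R c > 0" "c = 1 / (2 * (L_R c)\<^sup>2) - L_R c"
proof -
  have "\<exists>x. 0 \<le> x \<and> x \<le> 1 \<and> (\<lambda>x. 2 * x ^ 3 + 2 * c * x\<^sup>2) x = 1"
    using c by (intro IVT) (auto intro!: continuous_intros)
  then obtain x where x: "0 \<le> x" "2 * x ^ 3 + 2 * c * x\<^sup>2 = 1" by blast
  have x0: "x > 0" using x by (cases "x = 0") auto
  have cx: "c = 1 / (2 * x\<^sup>2) - x"
    using x x0 by (simp add: field_simps power2_eq_square power3_eq_cube)
  have lt: "1 / (2 * b\<^sup>2) - b < 1 / (2 * a\<^sup>2) - a" if "0 < a" "a < b" for a b :: real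
  proof -
    have "a\<^sup>2 < b\<^sup>2" using that by (simp add: power_strict_mono)
    then have "1 / (2 * b\<^sup>2) < 1 / (2 * a\<^sup>2)" using that by (simp add: frac_less2)
    then show ?thesis using that by simp
  qed
  have "L_R c = x"
    unfolding L_R_def
  proof (rule the_equality)
    show "0 < x \<and> c = 1 / (2 * x\<^sup>2) - x" using x0 cx by blast
    fix y assume y: "0 < y \<and> c = 1 / (2 * y\<^sup>2) - y"
    show "y = x" using lt[of x y] lt[of y x] x0 y cx by (cases x y rule: linorder_cases) auto
  qed
  then show "L_R c > 0" "c = 1 / (2 * (L_R c)\<^sup>2) - L_R c" using x0 cx by simp_all
qed

theorem corollary7p1:
  fixes c :: real
  assumes "c > 3/2"
  shows "has_systole (Sigma_R c) lambda_can (systole (Sigma_R c) lambda_can) \<and>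
         systole (Sigma_R c) lambda_can = 2 * pi * L_R c"
proof -
  note c = assms
  define L where "L = L_R c"
  have L: "L > 0" and cL: "c = 1 / (2 * L\<^sup>2) - L" using L_R_root[OF c] by (simp_all add: L_def)
  define M where "M = bounded_level c"
  have "2 * pi * L \<in> reeb_periods M lambda_can"
  proof -
    define r where "r = 1 / L"
    have r: "r > 0" "c = r\<^sup>2 / 2 - 1 / r" using L cL by (simp_all add: r_def power_divide)
    have "2 * pi * L = 2 * pi / r" by (simp add: r_def)
    then show ?thesis
      unfolding reeb_periods_def mem_Collect_eq M_def
      using circular_reeb_orbit[OF r] circular_orbit_periodic[OF r(1)] r(1) by auto
  qed
  moreover have "2 * pi * L \<le> T" if T: "T \<in> reeb_periods M lambda_can" for T
  proof -
    obtain \<gamma> where "T > 0" "reeb_orbit M lambda_can \<gamma>" "\<And>t. \<gamma> (t + T) = \<gamma> t"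
      using T by (auto simp: reeb_periods_def)
    then obtain r where r: "r > 0" "r\<^sup>2 / 2 - 1 / r \<le> c" "2 * pi / r \<le> T"
      using reeb_period_bound[OF c] unfolding M_def by blast
    have "L \<le> 1 / r"
    proof (rule ccontr)
      assume "\<not> L \<le> 1 / r"
      then have lt: "1 / r < L" by simp
      then have "1 / L < r" using r L by (simp add: field_simps)
      then have "(1 / L)\<^sup>2 < r\<^sup>2" using L by (intro power_strict_mono) auto
      then show False using r lt cL by (simp add: power_divide)
    qed
    then have "2 * pi * L \<le> 2 * pi * (1 / r)" by (intro mult_left_mono) auto
    then show ?thesis using r(3) by simp
  qed
  ultimately have sys: "has_systole M lambda_can (2 * pi * L)" by (simp add: has_systole_def)
  have "systole M lambda_can = 2 * pi * L"
    unfolding systole_def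
  proof (rule the_equality[where P = "has_systole M lambda_can"])
    show "has_systole M lambda_can (2 * pi * L)" by (rule sys)
    fix l assume "has_systole M lambda_can l"
    then show "l = 2 * pi * L" using sys by (auto simp: has_systole_def intro: antisym)
  qed
  then show ?thesis using sys by (simp add: Sigma_R_eq[OF c] M_def L_def)
qed

end
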